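(* Let $\Gamma$ be a countable discrete sofic group acting by homeomorphisms on a nonempty compact metrizable space $X$, and let $\Sigma=\{\sigma_i:\Gamma\to\mathrm{Sym}(d_i)\}_{i\ge 1}$ be a sofic approximation of $\Gamma$. Then there exists a common value $$D_\Sigma(X,\Gamma)\in\{-\infty\}\cup[0,+\infty]$$ such that, for every $1\le p<\infty$, $$D_\Sigma(X,\Gamma)=\mathrm{mdim}_{\Sigma,\mathrm M,p}(X,\Gamma)=\mathrm{mdim}_{\Sigma,\mathrm M,\infty}(X,\Gamma).$$ Moreover, for every $1\le q\le\infty$, $$D_\Sigma(X,\Gamma)=\inf_{\rho\in\mathcal T(X)}\underline{\mathrm{mdim}}_{\Sigma,q}(X,\rho),$$ where $\mathcal T(X)$ is the set of all compatible metrics on $X$ having tame growth of covering numbers.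
   Context: For $d\in\mathbb N=\{1,2,\dots\}$, $[d]=\{1,\dots,d\}$ and $\mathrm{Sym}(d)$ is the permutation group of $[d]$. A sofic approximation of a countable group $\Gamma$ is a sequence of maps $\Sigma=\{\sigma_i:\Gamma\to\mathrm{Sym}(d_i)\}_{i=1}^\infty$ such that (1) for all $s,t\in\Gamma$, $\lim_i \frac1{d_i}|\{v\in[d_i]:\sigma_i(s)\sigma_i(t)(v)=\sigma_i(st)(v)\}|=1$; (2) for all distinct $s,t\in\Gamma$, $\lim_i\frac1{d_i}|\{v\in[d_i]:\sigma_i(s)(v)=\sigma_i(t)(v)\}|=0$; (3) $\lim_i d_i=+\infty$. $\Gamma$ is sofic if it has a sofic approximation. For a map $\sigma:\Gamma\to\mathrm{Sym}(d)$ write $\sigma_s=\sigma(s)$. For a pseudometric space $(Y,\rho)$ and $\varepsilon>0$, a subset $E\subseteq Y$ is $(\rho,\varepsilon)$-spanning if for every $y\in Y$ there is $x\in E$ with $\rho(x,y)<\varepsilon$; $\mathrm S_\varepsilon(Y,\rho)$ is the least cardinality of a $(\rho,\varepsilon)$-spanning subset of $Y$. Conventions: $\mathrm S_\varepsilon(\varnothing,\rho)=0$, $\log 0=-\infty$. For a continuous pseudometric $\rho$ on $X$ and maps $\varphi,\psi:[d]\to X$, put $\rho_p(\varphi,\psi)=\left(\frac1d\sum_{v=1}^d\rho(\varphi(v),\psi(v))^p\right)^{1/p}$ for $1\le p<\infty$ and $\rho_\infty(\varphi,\psi)=\max_{1\le v\le d}\rho(\varphi(v),\psi(v))$. For nonempty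 finite $F\subseteq\Gamma$, $\delta>0$ and $\sigma:\Gamma\to\mathrm{Sym}(d)$, let $\mathrm{Map}(\rho,F,\delta,\sigma)=\{\varphi:[d]\to X:\ \rho_2(\varphi\circ\sigma_s,s\varphi)<\delta\text{ for every }s\in F\}$, where $(s\varphi)(v)=s\varphi(v)$. A continuous pseudometric $\rho$ on $X$ is dynamically generating if for every distinct $x,y\in X$ there is $s\in\Gamma$ with $\rho(sx,sy)>0$. A compatible metric on $X$ is a metric inducing the topology of $X$; every compatible metric is dynamically generating. For $\rho$ a dynamically generating continuous pseudometric, $1\le p\le\infty$ and $\varepsilon>0$, define $$h_{\Sigma,p}(\varepsilon,\rho)=\inf_{F}\inf_{\delta>0}\limsup_{i\to\infty}\frac1{d_i}\log\mathrm S_\varepsilon\bigl(\mathrm{Map}(\rho,F,\delta,\sigma_i),\rho_p\bigr),$$ with $F$ ranging over nonempty finite subsets of $\Gamma$ (the value is $-\infty$ if for some $F,\delta$ the sets $\mathrm{Map}(\rho,F,\delta,\sigma_i)$ are empty for all sufficiently large $i$). Define $$\underline{\mathrm{mdim}}_{\Sigma,p}(X,\rho)=\liminf_{\varepsilon\downarrow0}\frac{h_{\Sigma,p}(\varepsilon,\rho)}{\log(1/\varepsilon)},\qquad \mathrm{mdim}_{\Sigma,\mathrm M,p}(X,\Gamma)=\inf_\rho\underline{\mathrm{mdim}}_{\Sigma,p}(X,\rho),$$ the infimum being over all dynamically generating continuous pseudometrics $\rho$ on $X$. A compact metric space $(X,\rho)$ has tame growth of covering numbers if for every $a>0$, $\lim_{\varepsilon\downarrow0}\varepsilon^a\log\mathrm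 S_\varepsilon(X,\rho)=0$. *)

theory Defs
  imports "HOL-Analysis.Analysis" "HOL-Algebra.Group_Action" "HOL-Algebra.Sym_Groups"
begin

definition sofic_approximation ::
  "('g, 'm) monoid_scheme \<Rightarrow> (nat \<Rightarrow> nat) \<Rightarrow> (nat \<Rightarrow> 'g \<Rightarrow> nat \<Rightarrow> nat) \<Rightarrow> bool"
where
  "sofic_approximation G d \<sigma> \<longleftrightarrow>
     (\<forall>i. 1 \<le> d i) \<and>
     (\<forall>i. \<sigma> i \<in> carrier G \<rightarrow> carrier (sym_group (d i))) \<and>
     (\<forall>s\<in>carrier G. \<forall>t\<in>carrier G.
        (\<lambda>i. real (card {v \<in> {1..d i}. \<sigma> i s (\<sigma> i t v) = \<sigma> i (s \<otimes>\<^bsub>G\<^esub> t) v}) / real (d i))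
          \<longlonglongrightarrow> 1) \<and>
     (\<forall>s\<in>carrier G. \<forall>t\<in>carrier G. s \<noteq> t \<longrightarrow>
        (\<lambda>i. real (card {v \<in> {1..d i}. \<sigma> i s v = \<sigma> i t v}) / real (d i)) \<longlonglongrightarrow> 0) \<and>
     filterlim d at_top sequentially"

definition sofic_group :: "('g, 'm) monoid_scheme \<Rightarrow> bool" where
  "sofic_group G \<longleftrightarrow> (\<exists>d \<sigma>. sofic_approximation G d \<sigma>)"

text \<open>
  The value is \<open>\<infinity>\<close> if there is no finite spanning set.
\<close>

definition spanning_number :: "real \<Rightarrow> 'y set \<Rightarrow> ('y \<Rightarrow> 'y \<Rightarrow> real) \<Rightarrow> enat" where
  "spanning_number \<epsilon> Y \<rho> =
     Inf {enat (card E) |E. finite E \<and> E \<subseteq> Y \<and> (\<forall>y\<in>Y. \<exists>x\<in>E. \<rho> x y < \<epsilon>)}"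

definition elog :: "enat \<Rightarrow> ereal" where
  "elog n = (case n of enat k \<Rightarrow> (if k = 0 then -\<infinity> else ereal (ln (real k))) | \<infinity> \<Rightarrow> \<infinity>)"

text \<open>
  Since \<open>0 powr p = 0\<close>, the formula for finite \<open>p\<close> is correct also when some distances vanish.
  It is only used for \<open>1 \<le> d\<close> and \<open>1 \<le> p\<close>.
\<close>

definition map_dist ::
  "ereal \<Rightarrow> nat \<Rightarrow> ('x \<Rightarrow> 'x \<Rightarrow> real) \<Rightarrow> (nat \<Rightarrow> 'x) \<Rightarrow> (nat \<Rightarrow> 'x) \<Rightarrow> real"
where
  "map_dist p d \<rho> \<phi> \<psi> =
     (if p = \<infinity> then Max ((\<lambda>v. \<rho> (\<phi> v) (\<psi> v)) ` {1..d})
      else ((\<Sum>v=1..d. \<rho> (\<phi> v) (\<psi> v) powr real_of_ereal p) / real d)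
             powr (1 / real_of_ereal p))"

text \<open>
  Maps from \<open>{1..d}\<close> to the space are represented by functions that are \<open>undefined\<close> outside
  \<open>{1..d}\<close>. The argument \<open>\<alpha>\<close> is the action and \<open>\<tau>\<close> a map from the group to \<open>sym_group d\<close>.
\<close>

definition approx_equivariant_maps ::
  "'x topology \<Rightarrow> ('g \<Rightarrow> 'x \<Rightarrow> 'x) \<Rightarrow> ('x \<Rightarrow> 'x \<Rightarrow> real) \<Rightarrow> 'g set \<Rightarrow> real \<Rightarrow> nat
     \<Rightarrow> ('g \<Rightarrow> nat \<Rightarrow> nat) \<Rightarrow> (nat \<Rightarrow> 'x) set"
where
  "approx_equivariant_maps X \<alpha> \<rho> F \<delta> d \<tau> =
     {\<phi> \<in> {1..d} \<rightarrow>\<^sub>E topspace X.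
        \<forall>s\<in>F. map_dist 2 d \<rho> (\<phi> \<circ> \<tau> s) (\<lambda>v. \<alpha> s (\<phi> v)) < \<delta>}"

definition continuous_pseudometric :: "'x topology \<Rightarrow> ('x \<Rightarrow> 'x \<Rightarrow> real) \<Rightarrow> bool" where
  "continuous_pseudometric X \<rho> \<longleftrightarrow>
     (\<forall>x\<in>topspace X. \<forall>y\<in>topspace X. 0 \<le> \<rho> x y) \<and>
     (\<forall>x\<in>topspace X. \<rho> x x = 0) \<and>
     (\<forall>x\<in>topspace X. \<forall>y\<in>topspace X. \<rho> x y = \<rho> y x) \<and>
     (\<forall>x\<in>topspace X. \<forall>y\<in>topspace X. \<forall>z\<in>topspace X. \<rho> x z \<le> \<rho> x y + \<rho> y z) \<and>
     continuous_map (prod_topology X X) euclideanreal (\<lambda>(x, y). \<rho> x y)"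

definition dynamically_generating ::
  "('g, 'm) monoid_scheme \<Rightarrow> 'x topology \<Rightarrow> ('g \<Rightarrow> 'x \<Rightarrow> 'x) \<Rightarrow> ('x \<Rightarrow> 'x \<Rightarrow> real) \<Rightarrow> bool"
where
  "dynamically_generating G X \<alpha> \<rho> \<longleftrightarrow>
     (\<forall>x\<in>topspace X. \<forall>y\<in>topspace X. x \<noteq> y \<longrightarrow> (\<exists>s\<in>carrier G. 0 < \<rho> (\<alpha> s x) (\<alpha> s y)))"

definition compatible_metric :: "'x topology \<Rightarrow> ('x \<Rightarrow> 'x \<Rightarrow> real) \<Rightarrow> bool" where
  "compatible_metric X \<rho> \<longleftrightarrow>
     Metric_space (topspace X) \<rho> \<and> Metric_space.mtopology (topspace X) \<rho> = X"

definition tame_growth :: "'x topology \<Rightarrow> ('x \<Rightarrow> 'x \<Rightarrow> real) \<Rightarrow> bool" where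
  "tame_growth X \<rho> \<longleftrightarrow>
     (\<forall>a>0. ((\<lambda>\<epsilon>. ereal (\<epsilon> powr a) * elog (spanning_number \<epsilon> (topspace X) \<rho>)) \<longlongrightarrow> 0)
        (at_right 0))"

definition sofic_entropy ::
  "('g, 'm) monoid_scheme \<Rightarrow> 'x topology \<Rightarrow> ('g \<Rightarrow> 'x \<Rightarrow> 'x) \<Rightarrow> (nat \<Rightarrow> nat)
     \<Rightarrow> (nat \<Rightarrow> 'g \<Rightarrow> nat \<Rightarrow> nat) \<Rightarrow> ereal \<Rightarrow> real \<Rightarrow> ('x \<Rightarrow> 'x \<Rightarrow> real) \<Rightarrow> ereal"
where
  "sofic_entropy G X \<alpha> d \<sigma> p \<epsilon> \<rho> =
     (INF F\<in>{F. finite F \<and> F \<noteq> {} \<and> F \<subseteq> carrier G}. INF \<delta>\<in>{0<..}.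
        limsup (\<lambda>i. ereal (1 / real (d i)) *
          elog (spanning_number \<epsilon> (approx_equivariant_maps X \<alpha> \<rho> F \<delta> (d i) (\<sigma> i))
                  (map_dist p (d i) \<rho>))))"

definition lower_sofic_mdim ::
  "('g, 'm) monoid_scheme \<Rightarrow> 'x topology \<Rightarrow> ('g \<Rightarrow> 'x \<Rightarrow> 'x) \<Rightarrow> (nat \<Rightarrow> nat)
     \<Rightarrow> (nat \<Rightarrow> 'g \<Rightarrow> nat \<Rightarrow> nat) \<Rightarrow> ereal \<Rightarrow> ('x \<Rightarrow> 'x \<Rightarrow> real) \<Rightarrow> ereal"
where
  "lower_sofic_mdim G X \<alpha> d \<sigma> p \<rho> =
     Liminf (at_right 0) (\<lambda>\<epsilon>. sofic_entropy G X \<alpha> d \<sigma> p \<epsilon> \<rho> / ereal (ln (1 / \<epsilon>)))"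

definition sofic_metric_mdim ::
  "('g, 'm) monoid_scheme \<Rightarrow> 'x topology \<Rightarrow> ('g \<Rightarrow> 'x \<Rightarrow> 'x) \<Rightarrow> (nat \<Rightarrow> nat)
     \<Rightarrow> (nat \<Rightarrow> 'g \<Rightarrow> nat \<Rightarrow> nat) \<Rightarrow> ereal \<Rightarrow> ereal"
where
  "sofic_metric_mdim G X \<alpha> d \<sigma> p =
     (INF \<rho>\<in>{\<rho>. continuous_pseudometric X \<rho> \<and> dynamically_generating G X \<alpha> \<rho>}.
        lower_sofic_mdim G X \<alpha> d \<sigma> p \<rho>)"

end

theory Submission
  imports Defs "HOL-Real_Asymp.Real_Asymp"
begin

text \<open>
  Write \<open>I(q)\<close> for the infimum of the lower dimensions with exponent \<open>q\<close> over the generating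
  pseudometrics, and \<open>T(q)\<close> for the infimum over the tame compatible metrics. An average of order
  \<open>q\<close> lies between the ordinary average and the maximum, and every compatible metric is generating.
  Hence \<open>I(1) \<le> I(q) \<le> I(\<infinity>)\<close> and \<open>I(q) \<le> T(q) \<le> T(\<infinity>)\<close>, so that all these numbers coincide once
  \<open>T(\<infinity>) \<le> I(1)\<close> is known. This is the content of \<open>tame_metric_below_pseudometric\<close>: below the
  dimension of a generating pseudometric \<open>\<rho>\<close> with exponent \<open>1\<close> there is the dimension of a tame
  compatible metric \<open>D\<close> with exponent \<open>\<infinity>\<close>.

  The metric is \<open>D x y = (\<Sum>n. \<bar>\<rho> (s\<^sub>n x) z\<^sub>n - \<rho> (s\<^sub>n y) z\<^sub>n\<bar> / 2\<^sup>n\<^sup>+\<^sup>1)\<close>, where \<open>(s\<^sub>n, z\<^sub>n)\<close> runs through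
  all pairs of a group element and a point of a \<open>\<rho>\<close>-dense sequence. Three properties matter.

  \<^item> \<open>D\<close> places the space in a cube whose sides shrink geometrically. Only about \<open>log (1/r)\<close> of the
    coordinates are visible at scale \<open>r\<close>, so there are at most \<open>K = exp (O (log\<^sup>2 (1/r)))\<close> cells of
    diameter below \<open>r\<close> (\<open>coord_dist_code\<close>). In particular \<open>D\<close> is tame.

  \<^item> A coordinate is controlled by \<open>\<rho>\<close> after translation by \<open>s\<^sub>n\<close>. On almost equivariant maps such a
    translation amounts to a permutation of \<open>{1..d}\<close>, and permutations preserve averages. So the
    average of \<open>D\<close> over \<open>{1..d}\<close> exceeds that of \<open>\<rho>\<close> by an arbitrarily small amount only
    (\<open>average_coord_dist_le\<close>).

  \<^item> If the average of \<open>D\<close> between two maps is at most \<open>3\<epsilon>\<close>, then by Markov's inequality their values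
    are \<open>r\<close>-close outside a fraction \<open>3\<epsilon>/r\<close> of \<open>{1..d}\<close>. Recording the exceptional places and the
    cells of the values there turns closeness on average into uniform closeness, and it multiplies
    the spanning number by at most \<open>2\<^sup>d\<close> times a power of \<open>K\<close> with exponent \<open>3\<epsilon>d/r\<close>
    (\<open>spanning_number_uniform_le\<close>).

  With \<open>r = \<epsilon> log\<^sup>3 (1/\<epsilon>)\<close> the logarithm of the last factor, divided by \<open>d\<close>, stays bounded as \<open>\<epsilon>\<close>
  tends to \<open>0\<close>, while \<open>log (1/r)\<close> is asymptotic to \<open>log (1/\<epsilon>)\<close>. After division by the logarithmic
  scale the price of uniform closeness therefore vanishes.
\<close>

section \<open>Continuous pseudometrics on compact spaces\<close>

lemma continuous_pseudometricD:
  assumes "continuous_pseudometric X \<rho>"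
  shows "\<And>x y. x \<in> topspace X \<Longrightarrow> y \<in> topspace X \<Longrightarrow> 0 \<le> \<rho> x y"
    and "\<And>x. x \<in> topspace X \<Longrightarrow> \<rho> x x = 0"
    and "\<And>x y. x \<in> topspace X \<Longrightarrow> y \<in> topspace X \<Longrightarrow> \<rho> x y = \<rho> y x"
    and "\<And>x y z. x \<in> topspace X \<Longrightarrow> y \<in> topspace X \<Longrightarrow> z \<in> topspace X \<Longrightarrow> \<rho> x z \<le> \<rho> x y + \<rho> y z"
    and "continuous_map (prod_topology X X) euclideanreal (\<lambda>(x, y). \<rho> x y)"
  using assms unfolding continuous_pseudometric_def by blast+

lemma continuous_pseudometric_bounded:
  assumes "continuous_pseudometric X \<rho>" "compact_space X"
  obtains B where "1 \<le> B" "\<And>x y. x \<in> topspace X \<Longrightarrow> y \<in> topspace X \<Longrightarrow> \<rho> x y \<le> B"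
proof -
  let ?P = "prod_topology X X"
  have "compactin ?P (topspace ?P)"
    using assms(2) by (metis compact_space_def compact_space_prod_topology)
  then have "compact ((\<lambda>(x, y). \<rho> x y) ` topspace ?P)"
    using image_compactin[OF _ continuous_pseudometricD(5)[OF assms(1)]] by simp
  then obtain b where b: "\<And>u. u \<in> (\<lambda>(x, y). \<rho> x y) ` topspace ?P \<Longrightarrow> norm u \<le> b"
    by (meson bounded_iff compact_imp_bounded)
  have "\<rho> x y \<le> max 1 b" if "x \<in> topspace X" "y \<in> topspace X" for x y
    using b[of "\<rho> x y"] that by (force simp: image_iff)
  then show ?thesis by (intro that[of "max 1 b"]) auto
qed

lemma continuous_pseudometric_section:
  assumes "continuous_pseudometric X \<rho>" "z \<in> topspace X"
  shows "continuous_map X euclideanreal (\<lambda>x. \<rho> x z)"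
proof -
  have "continuous_map X (prod_topology X X) (\<lambda>x. (x, z))"
    using assms(2) by (simp add: continuous_map_pairedI)
  from continuous_map_compose[OF this continuous_pseudometricD(5)[OF assms(1)]]
  show ?thesis by (simp add: o_def)
qed

text \<open>
  A union of finite nets for the radii \<open>1/n\<close>, which exist by compactness because the balls of a
  continuous pseudometric are open.
\<close>

lemma continuous_pseudometric_dense_sequence:
  assumes \<rho>: "continuous_pseudometric X \<rho>" and X: "compact_space X" "topspace X \<noteq> {}"
  obtains z :: "nat \<Rightarrow> 'x"
  where "range z \<subseteq> topspace X" "\<And>x \<kappa>. x \<in> topspace X \<Longrightarrow> 0 < \<kappa> \<Longrightarrow> \<exists>j. \<rho> x (z j) < \<kappa>"
proof -
  have "\<exists>Z. finite Z \<and> Z \<subseteq> topspace X \<and> (\<forall>x\<in>topspace X. \<exists>z\<in>Z. \<rho> x z < \<kappa>)" if "0 < \<kappa>" for \<kappa> :: real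
  proof -
    define U where "U z = {x \<in> topspace X. \<rho> x z < \<kappa>}" for z
    have "openin X (U z)" if "z \<in> topspace X" for z
      using openin_continuous_map_preimage[OF continuous_pseudometric_section[OF \<rho> that], of "{..<\<kappa>}"]
      by (simp add: U_def open_lessThan)
    moreover have "topspace X \<subseteq> \<Union> (U ` topspace X)"
      using continuous_pseudometricD(2)[OF \<rho>] \<open>0 < \<kappa>\<close> by (auto simp: U_def)
    ultimately obtain \<F> where "finite \<F>" "\<F> \<subseteq> U ` topspace X" "topspace X \<subseteq> \<Union>\<F>"
      using X(1) unfolding compact_space_alt by (metis (no_types, lifting) imageE)
    then obtain Z where "Z \<subseteq> topspace X" "finite Z" "\<F> = U ` Z"
      by (meson finite_subset_image)
    with \<open>topspace X \<subseteq> \<Union>\<F>\<close> show ?thesis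
      by (intro exI[of _ Z]) (auto simp: U_def)
  qed
  then have "\<forall>n. \<exists>Z. finite Z \<and> Z \<subseteq> topspace X \<and> (\<forall>x\<in>topspace X. \<exists>z\<in>Z. \<rho> x z < inverse (real (Suc n)))"
    by (simp del: of_nat_Suc)
  then obtain Z where Z: "\<And>n. finite (Z n)" "\<And>n. Z n \<subseteq> topspace X"
    "\<And>n x. x \<in> topspace X \<Longrightarrow> \<exists>z\<in>Z n. \<rho> x z < inverse (real (Suc n))"
    by metis
  let ?C = "\<Union>n. Z n"
  have ne: "?C \<noteq> {}" using Z(3) X(2) by blast
  have ct: "countable ?C" using Z(1) by (simp add: countable_finite)
  show ?thesis
  proof (rule that[of "from_nat_into ?C"])
    show "range (from_nat_into ?C) \<subseteq> topspace X"
      using from_nat_into[OF ne] Z(2) by blast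
    fix x \<kappa> assume x: "x \<in> topspace X" "(0::real) < \<kappa>"
    obtain n where "inverse (real (Suc n)) < \<kappa>" using reals_Archimedean x(2) by blast
    moreover obtain z where "z \<in> Z n" "\<rho> x z < inverse (real (Suc n))" using Z(3) x(1) by blast
    moreover have "from_nat_into ?C (to_nat_on ?C z) = z"
      using ct \<open>z \<in> Z n\<close> by (intro from_nat_into_to_nat_on) auto
    ultimately show "\<exists>j. \<rho> x (from_nat_into ?C j) < \<kappa>"
      by (intro exI[of _ "to_nat_on ?C z"]) auto
  qed
qed

text \<open>
  The pairs at \<open>\<rho>\<close>-distance at least \<open>\<kappa>\<close> form a compact set off the diagonal, on which \<open>D\<close> attains a
  positive minimum.
\<close>

lemma separating_pseudometric_controls:
  assumes \<rho>: "continuous_pseudometric X \<rho>" and D: "continuous_pseudometric X D"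
    and X: "compact_space X"
    and sep: "\<And>x y. x \<in> topspace X \<Longrightarrow> y \<in> topspace X \<Longrightarrow> x \<noteq> y \<Longrightarrow> 0 < D x y"
    and "0 < \<kappa>"
  obtains \<tau> where "0 < \<tau>"
    "\<And>x y. x \<in> topspace X \<Longrightarrow> y \<in> topspace X \<Longrightarrow> D x y < \<tau> \<Longrightarrow> \<rho> x y < \<kappa>"
proof -
  let ?P = "prod_topology X X"
  define C where "C = {u \<in> topspace ?P. (\<lambda>(x, y). \<rho> x y) u \<in> {\<kappa>..}}"
  have "closedin ?P C"
    unfolding C_def using continuous_pseudometricD(5)[OF \<rho>]
    by (intro closedin_continuous_map_preimage) auto
  then have "compactin ?P C"
    using X by (simp add: closedin_compact_space compact_space_prod_topology)
  then have cpt: "compact ((\<lambda>(x, y). D x y) ` C)"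
    using image_compactin[OF _ continuous_pseudometricD(5)[OF D]] by simp
  show ?thesis
  proof (cases "C = {}")
    case True
    then show ?thesis by (intro that[of 1]) (auto simp: C_def not_le[symmetric])
  next
    case False
    then obtain m where m: "m \<in> (\<lambda>(x, y). D x y) ` C" "\<And>t. t \<in> (\<lambda>(x, y). D x y) ` C \<Longrightarrow> m \<le> t"
      using compact_attains_inf[OF cpt] by (metis image_is_empty)
    from m(1) obtain x y where xy: "x \<in> topspace X" "y \<in> topspace X" "\<kappa> \<le> \<rho> x y" "m = D x y"
      by (auto simp: C_def)
    then have "x \<noteq> y" using continuous_pseudometricD(2)[OF \<rho>] \<open>0 < \<kappa>\<close> by fastforce
    then have "0 < m" using sep xy by simp
    moreover have "\<rho> u v < \<kappa>" if "u \<in> topspace X" "v \<in> topspace X" "D u v < m" for u v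
    proof (rule ccontr)
      assume "\<not> \<rho> u v < \<kappa>"
      then have "(u, v) \<in> C" using that by (auto simp: C_def)
      then have "m \<le> D u v" by (intro m(2)) (force simp: image_iff)
      with that(3) show False by simp
    qed
    ultimately show ?thesis by (rule that)
  qed
qed

text \<open>
  The identity is a continuous bijection from a compact space onto a Hausdorff space. Symmetry and
  nonnegativity are required on the whole type because \<open>Metric_space\<close> demands them there.
\<close>

lemma compatible_metric_of_separating_pseudometric:
  assumes D: "continuous_pseudometric X D" and X: "compact_space X"
    and sep: "\<And>x y. x \<in> topspace X \<Longrightarrow> y \<in> topspace X \<Longrightarrow> x \<noteq> y \<Longrightarrow> 0 < D x y"
    and sym: "\<And>x y. D x y = D y x" and nonneg: "\<And>x y. 0 \<le> D x y"
  shows "compatible_metric X D"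
proof -
  have M: "Metric_space (topspace X) D"
    using continuous_pseudometricD[OF D] sep sym nonneg
    by unfold_locales (auto, fastforce)
  then interpret M: Metric_space "topspace X" D .
  have "continuous_map X M.mtopology id"
    unfolding M.continuous_map_to_metric
  proof (intro strip)
    fix x \<epsilon> assume x: "x \<in> topspace X" "(0::real) < \<epsilon>"
    have "openin X {y \<in> topspace X. D y x \<in> {..<\<epsilon>}}"
      by (rule openin_continuous_map_preimage[OF continuous_pseudometric_section[OF D x(1)]])
        (simp add: open_lessThan)
    moreover have "x \<in> {y \<in> topspace X. D y x \<in> {..<\<epsilon>}}" using x by simp
    ultimately show "\<exists>U. openin X U \<and> x \<in> U \<and> (\<forall>y\<in>U. id y \<in> M.mball (id x) \<epsilon>)"
      using x by (intro exI[of _ "{y \<in> topspace X. D y x \<in> {..<\<epsilon>}}"]) (auto simp: M.commute)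
  qed
  then have "homeomorphic_map X M.mtopology id"
    using X M.Hausdorff_space_mtopology by (intro continuous_imp_homeomorphic_map) auto
  then show ?thesis using M by (simp add: compatible_metric_def)
qed

lemma compatible_metric_imp_continuous_pseudometric:
  assumes "compatible_metric X \<rho>"
  shows "continuous_pseudometric X \<rho>"
proof -
  interpret M: Metric_space "topspace X" \<rho>
    using assms by (simp add: compatible_metric_def)
  have *: "mtopology_of (metric (topspace X, \<rho>)) = X"
    using assms by (simp add: compatible_metric_def)
  have "continuous_map (prod_topology X X) euclideanreal (\<lambda>u. \<rho> (fst u) (snd u))"
    using continuous_map_mdist[of "prod_topology X X" "metric (topspace X, \<rho>)" fst snd] *
    by (simp add: continuous_map_fst continuous_map_snd)
  then show ?thesis
    unfolding continuous_pseudometric_def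
    using M.triangle M.commute by (auto simp: case_prod_unfold)
qed

section \<open>Metrics built from a sequence of coordinate functions\<close>

lemma same_nat_floor_imp_close:
  fixes a b k :: real
  assumes "0 \<le> a" "0 \<le> b" "0 < k" "nat \<lfloor>k * a\<rfloor> = nat \<lfloor>k * b\<rfloor>"
  shows "k * \<bar>a - b\<bar> < 1"
proof -
  have "0 \<le> k * a" "0 \<le> k * b" using assms by simp_all
  then have "\<lfloor>k * a\<rfloor> = \<lfloor>k * b\<rfloor>" using assms(4) by (simp add: eq_nat_nat_iff)
  then have "\<bar>k * a - k * b\<bar> < 1" by linarith
  moreover have "k * \<bar>a - b\<bar> = \<bar>k * a - k * b\<bar>"
    using assms(3) by (simp add: abs_mult flip: right_diff_distrib)
  ultimately show ?thesis by simp
qed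

text \<open>
  The bounds on the coordinates are imposed on the whole type, so that the series below converges
  everywhere and its sum is symmetric and nonnegative without any membership conditions.
\<close>

locale bounded_coordinates =
  fixes g :: "nat \<Rightarrow> 'x \<Rightarrow> real" and B :: real
  assumes coord_range: "\<And>n x. g n x \<in> {0..B}" and B_ge_1: "1 \<le> B"
begin

definition coord_dist :: "'x \<Rightarrow> 'x \<Rightarrow> real" where
  "coord_dist x y = (\<Sum>n. \<bar>g n x - g n y\<bar> / 2 ^ Suc n)"

lemma coord_diff_le: "\<bar>g n x - g n y\<bar> \<le> B"
  using coord_range[of n x] coord_range[of n y] by auto

lemma geometric_tail_sums: "(\<lambda>n. B / 2 ^ Suc (n + N)) sums (B / 2 ^ N)"
proof -
  have "(\<lambda>n. B / 2 ^ N * (1/2) ^ Suc n) sums (B / 2 ^ N * 1)"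
    by (intro sums_mult power_half_series)
  then show ?thesis by (simp add: power_add power_divide field_simps)
qed

lemma coord_summable: "summable (\<lambda>n. \<bar>g n x - g n y\<bar> / 2 ^ Suc n)"
proof (rule summable_comparison_test')
  show "summable (\<lambda>n. B / 2 ^ Suc n)"
    using geometric_tail_sums[of 0] by (simp add: sums_iff)
  show "norm (\<bar>g n x - g n y\<bar> / 2 ^ Suc n) \<le> B / 2 ^ Suc n" if "0 \<le> n" for n
    using coord_diff_le by (simp add: divide_right_mono)
qed

lemma coord_dist_truncation:
  "coord_dist x y \<le> (\<Sum>n<N. \<bar>g n x - g n y\<bar> / 2 ^ Suc n) + B / 2 ^ N"
proof -
  have "coord_dist x y = (\<Sum>n. \<bar>g (n + N) x - g (n + N) y\<bar> / 2 ^ Suc (n + N))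
          + (\<Sum>n<N. \<bar>g n x - g n y\<bar> / 2 ^ Suc n)"
    unfolding coord_dist_def by (rule suminf_split_initial_segment[OF coord_summable])
  moreover have "(\<Sum>n. \<bar>g (n + N) x - g (n + N) y\<bar> / 2 ^ Suc (n + N)) \<le> (\<Sum>n. B / 2 ^ Suc (n + N))"
    using coord_diff_le geometric_tail_sums[of N] summable_ignore_initial_segment[OF coord_summable, of N]
    by (intro suminf_le) (auto simp: divide_right_mono sums_iff)
  moreover have "(\<Sum>n. B / 2 ^ Suc (n + N)) = B / 2 ^ N"
    using geometric_tail_sums[of N] by (simp add: sums_iff)
  ultimately show ?thesis by simp
qed

lemma coord_dist_ge_partial_sum: "(\<Sum>n<N. \<bar>g n x - g n y\<bar> / 2 ^ Suc n) \<le> coord_dist x y"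
  unfolding coord_dist_def by (intro sum_le_suminf coord_summable) auto

lemma coord_dist_nonneg: "0 \<le> coord_dist x y"
  unfolding coord_dist_def by (intro suminf_nonneg coord_summable) simp

lemma coord_dist_self: "coord_dist x x = 0"
  by (simp add: coord_dist_def)

lemma coord_dist_sym: "coord_dist x y = coord_dist y x"
  by (simp add: coord_dist_def abs_minus_commute)

lemma coord_dist_triangle: "coord_dist x z \<le> coord_dist x y + coord_dist y z"
proof -
  have "coord_dist x z \<le> (\<Sum>n. \<bar>g n x - g n y\<bar> / 2 ^ Suc n + \<bar>g n y - g n z\<bar> / 2 ^ Suc n)"
    unfolding coord_dist_def
  proof (intro suminf_le coord_summable summable_add)
    fix n
    have "\<bar>g n x - g n z\<bar> \<le> \<bar>g n x - g n y\<bar> + \<bar>g n y - g n z\<bar>" by linarith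
    then show "\<bar>g n x - g n z\<bar> / 2 ^ Suc n
        \<le> \<bar>g n x - g n y\<bar> / 2 ^ Suc n + \<bar>g n y - g n z\<bar> / 2 ^ Suc n"
      by (simp add: divide_right_mono flip: add_divide_distrib)
  qed
  also have "\<dots> = coord_dist x y + coord_dist y z"
    unfolding coord_dist_def by (rule suminf_add[symmetric]; rule coord_summable)
  finally show ?thesis .
qed

lemma coord_dist_separates:
  assumes "g n x \<noteq> g n y"
  shows "0 < coord_dist x y"
proof -
  have "0 < \<bar>g n x - g n y\<bar> / 2 ^ Suc n" using assms by simp
  also have "\<dots> \<le> (\<Sum>n<Suc n. \<bar>g n x - g n y\<bar> / 2 ^ Suc n)"
    by (simp add: sum_nonneg)
  also have "\<dots> \<le> coord_dist x y" by (rule coord_dist_ge_partial_sum)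
  finally show ?thesis .
qed

lemma coord_dist_continuous_pseudometric:
  assumes g: "\<And>n. continuous_map X euclideanreal (g n)"
  shows "continuous_pseudometric X coord_dist"
proof -
  let ?P = "prod_topology X X"
  define f where "f N u = (\<Sum>n<N. \<bar>g n (fst u) - g n (snd u)\<bar> / 2 ^ Suc n)" for N and u :: "'x \<times> 'x"
  have comp: "continuous_map ?P euclideanreal (\<lambda>u. g n (fst u))"
    "continuous_map ?P euclideanreal (\<lambda>u. g n (snd u))" for n
    using continuous_map_compose[OF continuous_map_fst[of X X] g[of n]]
      continuous_map_compose[OF continuous_map_snd[of X X] g[of n]] by (simp_all add: o_def)
  have f: "continuous_map ?P euclideanreal (f N)" for N
    unfolding f_def
    by (intro continuous_map_sum continuous_map_real_divide continuous_map_real_abs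
        continuous_map_diff comp) auto
  have dist: "dist (f N u) (case u of (x, y) \<Rightarrow> coord_dist x y) \<le> B / 2 ^ N" for N u
    using coord_dist_ge_partial_sum[where N=N, of "fst u" "snd u"] coord_dist_truncation[where N=N, of "fst u" "snd u"]
    by (simp add: f_def dist_real_def case_prod_unfold)
  have "continuous_map ?P Met_TC.mtopology (\<lambda>(x, y). coord_dist x y)"
  proof (rule Met_TC.continuous_map_uniform_limit[where F=sequentially and f=f])
    show "\<forall>\<^sub>F N in sequentially. continuous_map ?P Met_TC.mtopology (f N)"
      using f by simp
    fix \<epsilon> :: real assume "0 < \<epsilon>"
    have "(\<lambda>N. B / 2 ^ N) \<longlonglongrightarrow> 0" by real_asymp
    then have "\<forall>\<^sub>F N in sequentially. B / 2 ^ N < \<epsilon>"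
      using \<open>0 < \<epsilon>\<close> by (simp add: order_tendsto_iff)
    then show "\<forall>\<^sub>F N in sequentially. \<forall>u\<in>topspace ?P.
        (case u of (x, y) \<Rightarrow> coord_dist x y) \<in> UNIV \<and> dist (f N u) (case u of (x, y) \<Rightarrow> coord_dist x y) < \<epsilon>"
      by eventually_elim (use dist in \<open>auto intro: le_less_trans\<close>)
  qed simp
  then show ?thesis
    unfolding continuous_pseudometric_def
    using coord_dist_nonneg coord_dist_self
    by (auto intro: coord_dist_sym coord_dist_triangle)
qed

text \<open>
  An upper estimate for \<open>log\<close> of the number of cells of diameter below \<open>r\<close>: the first factor bounds
  the number of coordinates that have to be rounded, the second the logarithm of the number of
  rounded values of each of them. It grows like the square of \<open>log (1/r)\<close>.
\<close>

definition code_bound :: "real \<Rightarrow> real" where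
  "code_bound r = (log 2 (2 * B / r) + 1) * ln (4 * B / r + 1)"

text \<open>
  Coordinates with index at least \<open>N\<close> contribute at most \<open>r/2\<close> to a distance. Rounding each of the
  others to a multiple of \<open>r/4\<close> leaves an error of at most \<open>r/4\<close> in total, since the weights
  \<open>1/2\<^sup>n\<^sup>+\<^sup>1\<close> sum to \<open>1\<close>.
\<close>

lemma coord_dist_code:
  assumes r: "0 < r" "r < 1"
  obtains c :: "'x \<Rightarrow> nat \<Rightarrow> nat" and T
  where "finite T" "range c \<subseteq> T" "T \<noteq> {}" "ln (real (card T)) \<le> code_bound r"
    "\<And>x y. c x = c y \<Longrightarrow> coord_dist x y < r"
proof -
  define N where "N = nat \<lceil>log 2 (2 * B / r)\<rceil>"
  define m where "m = nat \<lfloor>4 * B / r\<rfloor>"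
  have big: "1 < 2 * B / r" "1 < 4 * B / r" using r B_ge_1 by (auto simp: field_simps)
  have N: "log 2 (2 * B / r) \<le> real N" "real N \<le> log 2 (2 * B / r) + 1"
    using big by (auto simp: N_def)
  have m: "real m \<le> 4 * B / r" using big by (simp add: m_def)
  have "2 * B / r = 2 powr (log 2 (2 * B / r))" using big by simp
  also have "\<dots> \<le> 2 powr real N" using N(1) by (intro powr_mono) auto
  finally have tail: "B / 2 ^ N \<le> r / 2" using r by (simp add: powr_realpow field_simps)
  define c where "c x = (\<lambda>n\<in>{..<N}. nat \<lfloor>4 / r * g n x\<rfloor>)" for x
  define T where "T = {..<N} \<rightarrow>\<^sub>E {..m}"
  show ?thesis
  proof (rule that[of T c])
    show "finite T" by (simp add: T_def finite_PiE)
    show "range c \<subseteq> T"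
    proof clarify
      fix x
      have "nat \<lfloor>4 / r * g n x\<rfloor> \<le> m" for n
        unfolding m_def using coord_range[of n x] r
        by (intro nat_mono floor_mono) (simp add: divide_right_mono)
      then show "c x \<in> T" by (auto simp: c_def T_def)
    qed
    then show "T \<noteq> {}" by blast
    have "real (card T) = (real m + 1) ^ N" by (simp add: T_def card_PiE add.commute)
    then have "ln (real (card T)) = real N * ln (real m + 1)" by (simp add: ln_realpow)
    also have "\<dots> \<le> (log 2 (2 * B / r) + 1) * ln (4 * B / r + 1)"
      using N m big by (intro mult_mono) auto
    finally show "ln (real (card T)) \<le> code_bound r" by (simp add: code_bound_def)
    fix x y assume eq: "c x = c y"
    have diff: "\<bar>g n x - g n y\<bar> \<le> r / 4" if "n < N" for n
    proof -
      have "nat \<lfloor>4 / r * g n x\<rfloor> = nat \<lfloor>4 / r * g n y\<rfloor>"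
        using fun_cong[OF eq, of n] that by (simp add: c_def)
      then have "4 / r * \<bar>g n x - g n y\<bar> < 1"
        using coord_range r by (intro same_nat_floor_imp_close) auto
      then show ?thesis using r by (simp add: divide_less_eq)
    qed
    have "(\<Sum>n<N. \<bar>g n x - g n y\<bar> / 2 ^ Suc n) \<le> (\<Sum>n<N. r / 4 * (1/2) ^ Suc n)"
      using diff by (intro sum_mono) (simp add: field_simps)
    also have "\<dots> = r / 4 * (\<Sum>n<N. (1/2) ^ Suc n)" by (simp add: sum_distrib_left)
    also have "(\<Sum>n<N. (1/2) ^ Suc n) \<le> (1::real)"
      using sum_le_suminf[OF sums_summable[OF power_half_series], of "{..<N}"]
        sums_unique[OF power_half_series] by simp
    then have "r / 4 * (\<Sum>n<N. (1/2) ^ Suc n) \<le> r / 4" using r by (simp add: mult_left_le)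
    finally show "coord_dist x y < r"
      using coord_dist_truncation[where N=N, of x y] tail r by linarith
  qed
qed

end

section \<open>Spanning numbers\<close>

lemma spanning_number_le_card:
  assumes "finite E" "E \<subseteq> Y" "\<And>y. y \<in> Y \<Longrightarrow> \<exists>x\<in>E. \<rho> x y < \<epsilon>"
  shows "spanning_number \<epsilon> Y \<rho> \<le> enat (card E)"
  unfolding spanning_number_def using assms by (intro Inf_lower) blast

lemma spanning_number_cases:
  obtains "spanning_number \<epsilon> Y \<rho> = \<infinity>"
  | E where "finite E" "E \<subseteq> Y" "\<And>y. y \<in> Y \<Longrightarrow> \<exists>x\<in>E. \<rho> x y < \<epsilon>" "spanning_number \<epsilon> Y \<rho> = enat (card E)"
proof (cases "{enat (card E) |E. finite E \<and> E \<subseteq> Y \<and> (\<forall>y\<in>Y. \<exists>x\<in>E. \<rho> x y < \<epsilon>)} = {}")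
  case True
  have "spanning_number \<epsilon> Y \<rho> = \<infinity>"
    unfolding spanning_number_def by (subst True) (simp add: top_enat_def)
  then show ?thesis by (rule that(1))
next
  case False
  then have "spanning_number \<epsilon> Y \<rho> \<in> {enat (card E) |E. finite E \<and> E \<subseteq> Y \<and> (\<forall>y\<in>Y. \<exists>x\<in>E. \<rho> x y < \<epsilon>)}"
    unfolding spanning_number_def using wellorder_InfI[where 'a=enat] by (metis (lifting) ex_in_conv)
  then show ?thesis using that(2) by auto
qed

lemma spanning_number_mono:
  assumes "\<And>x y. x \<in> Y \<Longrightarrow> y \<in> Y \<Longrightarrow> \<rho> x y \<le> \<rho>' x y"
  shows "spanning_number \<epsilon> Y \<rho> \<le> spanning_number \<epsilon> Y \<rho>'"
  unfolding spanning_number_def using assms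
  by (intro Inf_superset_mono subsetI) (smt (verit) mem_Collect_eq subsetD)

text \<open>
  One point is chosen for each code that occurs, which keeps the spanning set inside \<open>Y\<close>.
\<close>

lemma spanning_number_le_code:
  assumes "finite T" "c ` Y \<subseteq> T" "\<And>x y. x \<in> Y \<Longrightarrow> y \<in> Y \<Longrightarrow> c x = c y \<Longrightarrow> \<rho> x y < \<epsilon>"
  shows "spanning_number \<epsilon> Y \<rho> \<le> enat (card T)"
proof -
  let ?E = "inv_into Y c ` c ` Y"
  have fin: "finite (c ` Y)" using assms(1,2) finite_subset by blast
  have "spanning_number \<epsilon> Y \<rho> \<le> enat (card ?E)"
  proof (rule spanning_number_le_card)
    show "finite ?E" using fin by simp
    show "?E \<subseteq> Y" by (auto intro: inv_into_into)
    fix y assume "y \<in> Y"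
    then have "\<rho> (inv_into Y c (c y)) y < \<epsilon>"
      by (intro assms(3)) (simp_all add: inv_into_into f_inv_into_f)
    then show "\<exists>x\<in>?E. \<rho> x y < \<epsilon>" using \<open>y \<in> Y\<close> by blast
  qed
  also have "card ?E \<le> card T"
    using card_image_le[OF fin] card_mono[OF assms(1,2)] order_trans by blast
  finally show ?thesis by simp
qed

text \<open>
  A finer covering of a subset \<open>Y'\<close>, obtained from a spanning set of \<open>Y\<close>. The points of \<open>Y'\<close> near a
  given spanning point are coded relative to a reference point \<open>r\<close>. As the spanning point itself may
  lie outside \<open>Y'\<close>, the reference point is one of these nearby points of \<open>Y'\<close>; \<open>near r y\<close> says that
  \<open>r\<close> and \<open>y\<close> have a common \<open>\<epsilon>\<close>-close point in \<open>Y\<close>. The set \<open>T\<close> has to be nonempty since the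
  spanning number of \<open>Y\<close> may be infinite while \<open>\<infinity> * 0 = 0\<close>.
\<close>

lemma spanning_number_le_times_code:
  fixes c :: "'y \<Rightarrow> 'y \<Rightarrow> 't" and Y :: "'y set" and \<rho> :: "'y \<Rightarrow> 'y \<Rightarrow> real" and \<epsilon> :: real
  defines "near \<equiv> \<lambda>r y. \<exists>x\<in>Y. \<rho> x r < \<epsilon> \<and> \<rho> x y < \<epsilon>"
  assumes sub: "Y' \<subseteq> Y" and T: "finite T" "T \<noteq> {}"
    and code: "\<And>r y. r \<in> Y' \<Longrightarrow> y \<in> Y' \<Longrightarrow> near r y \<Longrightarrow> c r y \<in> T"
    and close: "\<And>r x y. r \<in> Y' \<Longrightarrow> x \<in> Y' \<Longrightarrow> y \<in> Y' \<Longrightarrow> near r x \<Longrightarrow> near r y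
      \<Longrightarrow> c r x = c r y \<Longrightarrow> \<rho>' x y < \<epsilon>'"
  shows "spanning_number \<epsilon>' Y' \<rho>' \<le> spanning_number \<epsilon> Y \<rho> * enat (card T)"
proof (cases rule: spanning_number_cases[of \<epsilon> Y \<rho>])
  case 1
  then show ?thesis using T by (simp add: imult_is_infinity card_gt_0_iff enat_0_iff)
next
  case (2 E)
  from 2(3) obtain e where e: "\<And>y. y \<in> Y \<Longrightarrow> e y \<in> E \<and> \<rho> (e y) y < \<epsilon>" by metis
  define rep where "rep x = (SOME r. r \<in> Y' \<and> \<rho> x r < \<epsilon>)" for x
  have rep: "rep (e y) \<in> Y'" "near (rep (e y)) y" if "y \<in> Y'" for y
  proof -
    have "\<exists>r. r \<in> Y' \<and> \<rho> (e y) r < \<epsilon>" using that e sub by blast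
    then have "rep (e y) \<in> Y' \<and> \<rho> (e y) (rep (e y)) < \<epsilon>" unfolding rep_def by (rule someI_ex)
    then show "rep (e y) \<in> Y'" "near (rep (e y)) y"
      using that e[of y] sub 2(2) unfolding near_def by (blast, meson subsetD)
  qed
  have "spanning_number \<epsilon>' Y' \<rho>' \<le> enat (card (E \<times> T))"
  proof (rule spanning_number_le_code[where c="\<lambda>y. (e y, c (rep (e y)) y)"])
    show "finite (E \<times> T)" using 2 T by simp
    show "(\<lambda>y. (e y, c (rep (e y)) y)) ` Y' \<subseteq> E \<times> T"
    proof clarify
      fix y assume y: "y \<in> Y'"
      then have "e y \<in> E" using e sub by blast
      then show "e y \<in> E \<and> c (rep (e y)) y \<in> T" using code[OF rep(1)[OF y] y rep(2)[OF y]] by blast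
    qed
  next
    fix x y assume xy: "x \<in> Y'" "y \<in> Y'" "(e x, c (rep (e x)) x) = (e y, c (rep (e y)) y)"
    show "\<rho>' x y < \<epsilon>'"
      by (rule close[of "rep (e x)"]) (use xy rep[of x] rep[of y] in auto)
  qed
  then show ?thesis using 2 by (simp add: card_cartesian_product)
qed

lemma elog_mono: "m \<le> n \<Longrightarrow> elog m \<le> elog n"
  by (auto simp: elog_def split: enat.splits)

lemma elog_times_le:
  assumes "1 \<le> M"
  shows "elog (n * enat M) \<le> elog n + ereal (ln (real M))"
proof (cases n)
  case (enat k)
  have "0 < real k \<Longrightarrow> ln (real k * real M) = ln (real k) + ln (real M)"
    using assms by (simp add: ln_mult)
  with enat assms show ?thesis by (auto simp: elog_def)
next
  case infinity
  with assms show ?thesis by (simp add: elog_def imult_is_infinity enat_0_iff)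
qed

lemma elog_nonneg_iff: "0 \<le> elog n \<longleftrightarrow> n \<noteq> 0"
  by (cases n) (auto simp: elog_def zero_enat_def)

lemma elog_zero: "elog 0 = -\<infinity>"
  by (simp add: elog_def zero_enat_def)

lemma spanning_number_eq_0_iff: "spanning_number \<epsilon> Y \<rho> = 0 \<longleftrightarrow> Y = {}"
proof
  assume *: "spanning_number \<epsilon> Y \<rho> = 0"
  show "Y = {}"
    by (cases rule: spanning_number_cases[of \<epsilon> Y \<rho>]) (use * in \<open>auto simp: zero_enat_def\<close>)
next
  assume "Y = {}"
  then show "spanning_number \<epsilon> Y \<rho> = 0"
    using spanning_number_le_card[of "{}" Y \<rho> \<epsilon>] by (simp add: zero_enat_def[symmetric])
qed

section \<open>Averaged distances between maps\<close>

text \<open>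
  With \<open>M\<close> the mean of order \<open>p\<close>, Young's inequality \<open>t \<le> t\<^sup>p / p + (1 - 1/p)\<close> is applied to each
  \<open>t = x v / M\<close> and summed.
\<close>

lemma average_le_power_mean:
  fixes x :: "nat \<Rightarrow> real"
  assumes "1 \<le> d" "1 \<le> p" and x: "\<And>v. v \<in> {1..d} \<Longrightarrow> 0 \<le> x v"
  shows "(\<Sum>v=1..d. x v) / real d \<le> ((\<Sum>v=1..d. x v powr p) / real d) powr (1 / p)"
proof -
  define S where "S = (\<Sum>v=1..d. x v powr p) / real d"
  define M where "M = S powr (1 / p)"
  have "0 \<le> S" by (simp add: S_def sum_nonneg)
  show ?thesis
  proof (cases "S = 0")
    case True
    then have "\<forall>v\<in>{1..d}. x v powr p = 0"
      using \<open>1 \<le> d\<close> by (simp add: S_def sum_nonneg_eq_0_iff)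
    then have "(\<Sum>v=1..d. x v) = 0" by (intro sum.neutral) auto
    then show ?thesis by simp
  next
    case False
    then have "0 < S" "0 < M" using \<open>0 \<le> S\<close> by (auto simp: M_def)
    have MS: "M powr p = S" using \<open>0 < S\<close> \<open>1 \<le> p\<close> by (simp add: M_def powr_powr)
    have young: "x v / M \<le> 1 / p * (x v powr p / S) + (1 - 1 / p)" if v: "v \<in> {1..d}" for v
    proof (cases "x v = 0")
      case True
      then show ?thesis using \<open>1 \<le> p\<close> by simp
    next
      case False
      then have "0 < x v / M" using x[OF v] \<open>0 < M\<close> by simp
      moreover have "(x v / M) powr p = x v powr p / S"
        using MS x[OF v] \<open>0 < M\<close> by (simp add: powr_divide)
      moreover have "((x v / M) powr p) powr (1 / p) = x v / M"
        using x[OF v] \<open>0 < M\<close> \<open>1 \<le> p\<close> by (simp add: powr_powr)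
      moreover have "0 < x v powr p / S" using False \<open>0 < S\<close> by simp
      ultimately show ?thesis
        using Youngs_inequality_0[of "1 / p" "1 - 1 / p" "(x v / M) powr p" 1] \<open>1 \<le> p\<close> by simp
    qed
    have "(\<Sum>v=1..d. x v) / M = (\<Sum>v=1..d. x v / M)" by (simp add: sum_divide_distrib)
    also have "\<dots> \<le> (\<Sum>v=1..d. 1 / p * (x v powr p / S) + (1 - 1 / p))"
      by (rule sum_mono) (rule young)
    also have "\<dots> = 1 / p * ((\<Sum>v=1..d. x v powr p) / S) + real d * (1 - 1 / p)"
      by (simp add: sum.distrib flip: sum_distrib_left sum_divide_distrib)
    also have "(\<Sum>v=1..d. x v powr p) / S = real d"
      using \<open>0 < S\<close> \<open>1 \<le> d\<close> by (simp add: S_def field_simps)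
    also have "1 / p * real d + real d * (1 - 1 / p) = real d" by (simp add: algebra_simps)
    finally have "(\<Sum>v=1..d. x v) \<le> M * real d" using \<open>0 < M\<close> by (simp add: field_simps)
    then show ?thesis using \<open>1 \<le> d\<close> by (simp add: M_def S_def field_simps)
  qed
qed

lemma map_dist_1:
  assumes "\<And>v. v \<in> {1..d} \<Longrightarrow> 0 \<le> \<rho> (\<phi> v) (\<psi> v)"
  shows "map_dist 1 d \<rho> \<phi> \<psi> = (\<Sum>v=1..d. \<rho> (\<phi> v) (\<psi> v)) / real d"
proof -
  have "0 \<le> (\<Sum>v=1..d. \<rho> (\<phi> v) (\<psi> v))" using assms by (rule sum_nonneg)
  moreover have "(\<Sum>v=1..d. \<bar>\<rho> (\<phi> v) (\<psi> v)\<bar>) = (\<Sum>v=1..d. \<rho> (\<phi> v) (\<psi> v))"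
    using assms by (intro sum.cong) auto
  ultimately show ?thesis using assms by (simp add: map_dist_def)
qed

lemma map_dist_2:
  assumes "\<And>v. v \<in> {1..d} \<Longrightarrow> 0 \<le> \<rho> (\<phi> v) (\<psi> v)"
  shows "map_dist 2 d \<rho> \<phi> \<psi> = sqrt ((\<Sum>v=1..d. (\<rho> (\<phi> v) (\<psi> v))\<^sup>2) / real d)"
proof -
  have "(2::ereal) \<noteq> \<infinity>" "real_of_ereal 2 = 2" by simp_all
  then show ?thesis using assms by (simp add: map_dist_def powr_half_sqrt sum_nonneg)
qed

lemma map_dist_1_le:
  assumes d: "1 \<le> d" and p: "1 \<le> p" and nn: "\<And>v. v \<in> {1..d} \<Longrightarrow> 0 \<le> \<rho> (\<phi> v) (\<psi> v)"
  shows "map_dist 1 d \<rho> \<phi> \<psi> \<le> map_dist p d \<rho> \<phi> \<psi>"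
proof -
  have eq: "map_dist 1 d \<rho> \<phi> \<psi> = (\<Sum>v=1..d. \<rho> (\<phi> v) (\<psi> v)) / real d"
    using nn by (rule map_dist_1)
  show ?thesis
  proof (cases "p = \<infinity>")
    case True
    have "(\<Sum>v=1..d. \<rho> (\<phi> v) (\<psi> v)) \<le> (\<Sum>v=1..d. map_dist \<infinity> d \<rho> \<phi> \<psi>)"
      by (rule sum_mono) (simp add: map_dist_def)
    then have "(\<Sum>v=1..d. \<rho> (\<phi> v) (\<psi> v)) / real d \<le> map_dist \<infinity> d \<rho> \<phi> \<psi>"
      using d by (simp add: field_simps)
    then show ?thesis using eq True by simp
  next
    case False
    with p have "1 \<le> real_of_ereal p" by (cases p) auto
    then have "(\<Sum>v=1..d. \<rho> (\<phi> v) (\<psi> v)) / real d \<le> map_dist p d \<rho> \<phi> \<psi>"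
      using average_le_power_mean[OF d, of "real_of_ereal p" "\<lambda>v. \<rho> (\<phi> v) (\<psi> v)"] nn False
      by (simp add: map_dist_def)
    then show ?thesis using eq by simp
  qed
qed

lemma map_dist_le_infinity:
  assumes d: "1 \<le> d" and p: "1 \<le> p" and nn: "\<And>v. v \<in> {1..d} \<Longrightarrow> 0 \<le> \<rho> (\<phi> v) (\<psi> v)"
  shows "map_dist p d \<rho> \<phi> \<psi> \<le> map_dist \<infinity> d \<rho> \<phi> \<psi>"
proof (cases "p = \<infinity>")
  case False
  define r where "r = real_of_ereal p"
  have r: "1 \<le> r" using p False by (cases p) (auto simp: r_def)
  define M where "M = map_dist \<infinity> d \<rho> \<phi> \<psi>"
  have M: "\<rho> (\<phi> v) (\<psi> v) \<le> M" if "v \<in> {1..d}" for v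
    using that by (simp add: M_def map_dist_def)
  have "0 \<le> M" using M[of 1] nn[of 1] d by simp
  have "(\<Sum>v=1..d. \<rho> (\<phi> v) (\<psi> v) powr r) \<le> (\<Sum>v=1..d. M powr r)"
    using nn M r by (intro sum_mono powr_mono2) auto
  then have "(\<Sum>v=1..d. \<rho> (\<phi> v) (\<psi> v) powr r) / real d \<le> M powr r"
    using d by (simp add: field_simps)
  then have "((\<Sum>v=1..d. \<rho> (\<phi> v) (\<psi> v) powr r) / real d) powr (1 / r) \<le> (M powr r) powr (1 / r)"
    using r by (intro powr_mono2) (auto simp: sum_nonneg)
  also have "\<dots> = M" using r \<open>0 \<le> M\<close> by (simp add: powr_powr)
  finally show ?thesis using False by (simp add: map_dist_def r_def M_def)
qed simp

lemma map_dist_infinity_less: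
  assumes "1 \<le> d" "\<And>v. v \<in> {1..d} \<Longrightarrow> \<rho> (\<phi> v) (\<psi> v) < \<epsilon>"
  shows "map_dist \<infinity> d \<rho> \<phi> \<psi> < \<epsilon>"
  using assms by (simp add: map_dist_def)

text \<open>
  The passage from closeness on average to uniform closeness. A map \<open>\<psi>\<close> is described relative to a
  reference map \<open>\<phi>\<close> by the set \<open>W\<close> of places where the two are at distance at least \<open>r\<close>, together
  with the cells of the values of \<open>\<psi>\<close> on \<open>W\<close>. Maps with the same description are both \<open>r\<close>-close to
  \<open>\<phi>\<close> outside \<open>W\<close> and in common cells on \<open>W\<close>, hence uniformly \<open>2r\<close>-close. Markov's inequality bounds
  the size of \<open>W\<close>. Counting the sets \<open>W\<close> by \<open>2\<^sup>d\<close> is crude but costs only a bounded amount per place.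
\<close>

lemma spanning_number_uniform_le:
  fixes D :: "'x \<Rightarrow> 'x \<Rightarrow> real" and code :: "'x \<Rightarrow> 'c"
    and Y :: "(nat \<Rightarrow> 'x) set" and P :: "(nat \<Rightarrow> 'x) \<Rightarrow> (nat \<Rightarrow> 'x) \<Rightarrow> real"
  assumes d: "1 \<le> d" and r: "0 < r"
    and D: "\<And>x y. 0 \<le> D x y" "\<And>x y. D x y = D y x" "\<And>x y z. D x z \<le> D x y + D y z"
    and T: "finite T" "range code \<subseteq> T" "T \<noteq> {}"
    and code: "\<And>x y. code x = code y \<Longrightarrow> D x y < r"
    and sub: "Y' \<subseteq> Y"
    and near: "\<And>\<phi> \<psi> \<omega>. \<phi> \<in> Y' \<Longrightarrow> \<psi> \<in> Y' \<Longrightarrow> \<omega> \<in> Y \<Longrightarrow> P \<omega> \<phi> < \<epsilon> \<Longrightarrow> P \<omega> \<psi> < \<epsilon>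
      \<Longrightarrow> (\<Sum>v=1..d. D (\<phi> v) (\<psi> v)) / real d \<le> \<eta>"
  shows "spanning_number (2 * r) Y' (map_dist \<infinity> d D)
           \<le> spanning_number \<epsilon> Y P * enat (2 ^ d * card T ^ nat \<lfloor>\<eta> / r * real d\<rfloor>)"
proof -
  define m where "m = nat \<lfloor>\<eta> / r * real d\<rfloor>"
  define W where "W \<phi> \<psi> = {v \<in> {1..d}. r \<le> D (\<phi> v) (\<psi> v)}" for \<phi> \<psi> :: "nat \<Rightarrow> 'x"
  define \<W> where "\<W> = {V. V \<subseteq> {1..d} \<and> card V \<le> m}"
  define C where "C = (SIGMA V:\<W>. V \<rightarrow>\<^sub>E T)"
  have fin: "finite \<W>" "\<And>V. V \<in> \<W> \<Longrightarrow> finite V"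
    by (auto simp: \<W>_def intro: finite_subset)
  have K: "1 \<le> card T" using T by (simp add: Suc_le_eq card_gt_0_iff)
  have finC: "finite C" unfolding C_def using fin T by (intro finite_SigmaI finite_PiE) auto
  have neC: "C \<noteq> {}"
  proof -
    have "({}, \<lambda>_. undefined) \<in> C" by (simp add: C_def \<W>_def)
    then show ?thesis by blast
  qed
  have "card C = (\<Sum>V\<in>\<W>. card T ^ card V)"
    unfolding C_def using fin T by (subst card_SigmaI) (auto simp: card_PiE finite_PiE)
  also have "\<dots> \<le> (\<Sum>V\<in>\<W>. card T ^ m)"
    using K by (intro sum_mono power_increasing) (auto simp: \<W>_def)
  also have "\<dots> = card \<W> * card T ^ m" by simp
  also have "card \<W> \<le> card (Pow {1..d})" by (intro card_mono) (auto simp: \<W>_def)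
  then have "card \<W> * card T ^ m \<le> 2 ^ d * card T ^ m" by (simp add: card_Pow)
  finally have cardC: "card C \<le> 2 ^ d * card T ^ m" .
  have "spanning_number (2 * r) Y' (map_dist \<infinity> d D) \<le> spanning_number \<epsilon> Y P * enat (card C)"
  proof (rule spanning_number_le_times_code[where c="\<lambda>\<phi> \<psi>. (W \<phi> \<psi>, restrict (code \<circ> \<psi>) (W \<phi> \<psi>))",
        OF sub finC neC])
    fix \<phi> \<psi> assume in_Y': "\<phi> \<in> Y'" "\<psi> \<in> Y'" and "\<exists>\<omega>\<in>Y. P \<omega> \<phi> < \<epsilon> \<and> P \<omega> \<psi> < \<epsilon>"
    then have avg: "(\<Sum>v=1..d. D (\<phi> v) (\<psi> v)) \<le> \<eta> * real d"
      using near d by (auto simp: field_simps)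
    have "real (card (W \<phi> \<psi>)) * r = (\<Sum>v\<in>W \<phi> \<psi>. r)" by simp
    also have "\<dots> \<le> (\<Sum>v\<in>W \<phi> \<psi>. D (\<phi> v) (\<psi> v))" by (rule sum_mono) (simp add: W_def)
    also have "\<dots> \<le> (\<Sum>v=1..d. D (\<phi> v) (\<psi> v))" by (rule sum_mono2) (auto simp: W_def D(1))
    also note avg
    finally have "real (card (W \<phi> \<psi>)) \<le> \<eta> / r * real d" using r by (simp add: field_simps)
    then have "card (W \<phi> \<psi>) \<le> m" by (simp add: m_def le_nat_floor)
    then have "W \<phi> \<psi> \<in> \<W>" by (auto simp: \<W>_def W_def)
    then show "(W \<phi> \<psi>, restrict (code \<circ> \<psi>) (W \<phi> \<psi>)) \<in> C"
      using T(2) by (auto simp: C_def)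
  next
    fix \<phi> \<psi> \<psi>' assume "(W \<phi> \<psi>, restrict (code \<circ> \<psi>) (W \<phi> \<psi>)) = (W \<phi> \<psi>', restrict (code \<circ> \<psi>') (W \<phi> \<psi>'))"
    then have eq: "W \<phi> \<psi> = W \<phi> \<psi>'"
      and eq': "\<And>v. v \<in> W \<phi> \<psi> \<Longrightarrow> code (\<psi> v) = code (\<psi>' v)"
      by (auto dest: fun_cong split: if_splits)
    show "map_dist \<infinity> d D \<psi> \<psi>' < 2 * r"
    proof (rule map_dist_infinity_less[OF d])
      fix v assume v: "v \<in> {1..d}"
      show "D (\<psi> v) (\<psi>' v) < 2 * r"
      proof (cases "v \<in> W \<phi> \<psi>")
        case True
        then show ?thesis using code[OF eq'] r by fastforce
      next
        case False
        then have "v \<notin> W \<phi> \<psi>'" using eq by simp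
        with False have "D (\<phi> v) (\<psi> v) < r" "D (\<phi> v) (\<psi>' v) < r"
          using v by (auto simp: W_def not_le)
        then show ?thesis using D(2)[of "\<psi> v" "\<phi> v"] D(3)[of "\<psi> v" "\<psi>' v" "\<phi> v"] by linarith
      qed
    qed
  qed
  also have "\<dots> \<le> spanning_number \<epsilon> Y P * enat (2 ^ d * card T ^ m)"
    using cardC by (intro mult_left_mono) auto
  finally show ?thesis by (simp add: m_def)
qed

section \<open>Quotients by the logarithmic scale\<close>

text \<open>
  A lower limit can only increase along a reparametrization \<open>\<theta>\<close> tending to \<open>0\<close>, and under the
  assumptions on \<open>c\<close> and \<open>\<theta>\<close> neither the error \<open>c\<close> nor the change of scale survives the division.
  The argument separates the two lower limits by real numbers \<open>u < t\<close>, which avoids a case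
  distinction on infinite values.
\<close>

lemma Liminf_divide_ln_reparametrized:
  fixes h h' :: "real \<Rightarrow> ereal" and \<theta> c :: "real \<Rightarrow> real"
  assumes bound: "\<forall>\<^sub>F \<epsilon> in at_right 0. h' (\<theta> \<epsilon>) \<le> h \<epsilon> + ereal (c \<epsilon>)"
    and \<theta>: "filterlim \<theta> (at_right 0) (at_right 0)"
    and c: "((\<lambda>\<epsilon>. c \<epsilon> / ln (1 / \<theta> \<epsilon>)) \<longlongrightarrow> 0) (at_right 0)"
    and ratio: "((\<lambda>\<epsilon>. ln (1 / \<epsilon>) / ln (1 / \<theta> \<epsilon>)) \<longlongrightarrow> 1) (at_right 0)"
  shows "Liminf (at_right 0) (\<lambda>\<epsilon>. h' \<epsilon> / ereal (ln (1 / \<epsilon>)))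
      \<le> Liminf (at_right 0) (\<lambda>\<epsilon>. h \<epsilon> / ereal (ln (1 / \<epsilon>)))"
proof (rule ccontr)
  assume "\<not> ?thesis"
  then obtain t where t: "Liminf (at_right 0) (\<lambda>\<epsilon>. h \<epsilon> / ereal (ln (1 / \<epsilon>))) < ereal t"
    "ereal t < Liminf (at_right 0) (\<lambda>\<epsilon>. h' \<epsilon> / ereal (ln (1 / \<epsilon>)))"
    using ereal_dense2[of "Liminf (at_right 0) (\<lambda>\<epsilon>. h \<epsilon> / ereal (ln (1 / \<epsilon>)))"
        "Liminf (at_right 0) (\<lambda>\<epsilon>. h' \<epsilon> / ereal (ln (1 / \<epsilon>)))"] by (auto simp only: not_le)
  \<comment> \<open>A second real number leaves room for the error term and for the ratio of the scales.\<close>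
  obtain u where u: "Liminf (at_right 0) (\<lambda>\<epsilon>. h \<epsilon> / ereal (ln (1 / \<epsilon>))) < ereal u" "u < t"
    using ereal_dense2[OF t(1)] by auto
  have "\<forall>\<^sub>F \<epsilon> in at_right 0. ereal t < h' \<epsilon> / ereal (ln (1 / \<epsilon>))"
    by (rule less_LiminfD[OF t(2)])
  then have 1: "\<forall>\<^sub>F \<epsilon> in at_right 0. ereal t < h' (\<theta> \<epsilon>) / ereal (ln (1 / \<theta> \<epsilon>))"
    by (rule eventually_compose_filterlim[OF _ \<theta>])
  have lt1: "\<forall>\<^sub>F \<epsilon> in at_right (0::real). 0 < \<epsilon> \<and> \<epsilon> < 1"
    unfolding eventually_at_right_field by (intro exI[of _ 1]) simp
  then have 2: "\<forall>\<^sub>F \<epsilon> in at_right 0. 0 < \<theta> \<epsilon> \<and> \<theta> \<epsilon> < 1"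
    by (rule eventually_compose_filterlim[OF _ \<theta>])
  have "((\<lambda>\<epsilon>. u * (ln (1 / \<epsilon>) / ln (1 / \<theta> \<epsilon>)) + c \<epsilon> / ln (1 / \<theta> \<epsilon>)) \<longlongrightarrow> u * 1 + 0) (at_right 0)"
    by (intro tendsto_intros c ratio)
  then have 3: "\<forall>\<^sub>F \<epsilon> in at_right 0. u * (ln (1 / \<epsilon>) / ln (1 / \<theta> \<epsilon>)) + c \<epsilon> / ln (1 / \<theta> \<epsilon>) < t"
    using u(2) by (simp add: order_tendsto_iff)
  have "\<forall>\<^sub>F \<epsilon> in at_right 0. ereal u \<le> h \<epsilon> / ereal (ln (1 / \<epsilon>))"
    using bound lt1 1 2 3
  proof eventually_elim
    case (elim \<epsilon>)
    have L: "0 < ln (1 / \<epsilon>)" "0 < ln (1 / \<theta> \<epsilon>)" using elim by simp_all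
    have c: "ln (1 / \<epsilon>) * u + c \<epsilon> < ln (1 / \<theta> \<epsilon>) * t"
    proof -
      have "ln (1 / \<theta> \<epsilon>) * (u * (ln (1 / \<epsilon>) / ln (1 / \<theta> \<epsilon>)) + c \<epsilon> / ln (1 / \<theta> \<epsilon>)) < ln (1 / \<theta> \<epsilon>) * t"
        using elim(5) L(2) by (rule mult_strict_left_mono)
      moreover have "ln (1 / \<theta> \<epsilon>) * (u * (ln (1 / \<epsilon>) / ln (1 / \<theta> \<epsilon>)) + c \<epsilon> / ln (1 / \<theta> \<epsilon>)) = ln (1 / \<epsilon>) * u + c \<epsilon>"
        using L(2) by (simp only: distrib_left) simp
      ultimately show ?thesis by simp
    qed
    have "\<not> h' (\<theta> \<epsilon>) \<le> ereal (ln (1 / \<theta> \<epsilon>)) * ereal t"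
    proof -
      have "h' (\<theta> \<epsilon>) / ereal (ln (1 / \<theta> \<epsilon>)) \<le> ereal t \<longleftrightarrow> h' (\<theta> \<epsilon>) \<le> ereal (ln (1 / \<theta> \<epsilon>)) * ereal t"
        using L(2) by (intro ereal_divide_le_pos) auto
      with elim(3) show ?thesis by (metis leD)
    qed
    then have "ereal (ln (1 / \<theta> \<epsilon>) * t) < h \<epsilon> + ereal (c \<epsilon>)"
      using elim(1) by (simp only: not_le times_ereal.simps)
    moreover have "ereal (ln (1 / \<epsilon>) * u + c \<epsilon>) < ereal (ln (1 / \<theta> \<epsilon>) * t)"
      using c by simp
    ultimately have "ereal (ln (1 / \<epsilon>) * u + c \<epsilon>) < h \<epsilon> + ereal (c \<epsilon>)"
      by (rule less_trans[rotated])
    then have "ereal (ln (1 / \<epsilon>)) * ereal u \<le> h \<epsilon>"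
      by (cases "h \<epsilon>") simp_all
    moreover have "ereal u \<le> h \<epsilon> / ereal (ln (1 / \<epsilon>)) \<longleftrightarrow> ereal (ln (1 / \<epsilon>)) * ereal u \<le> h \<epsilon>"
      using L(1) by (intro ereal_le_divide_pos) auto
    ultimately show ?case by blast
  qed
  then have "ereal u \<le> Liminf (at_right 0) (\<lambda>\<epsilon>. h \<epsilon> / ereal (ln (1 / \<epsilon>)))"
    by (rule Liminf_bounded)
  with u(1) show False by simp
qed

section \<open>Sofic entropy and its dependence on the exponent\<close>

locale sofic_dynamics =
  fixes G :: "('g, 'm) monoid_scheme" and X :: "'x topology" and \<alpha> :: "'g \<Rightarrow> 'x \<Rightarrow> 'x"
    and d :: "nat \<Rightarrow> nat" and \<sigma> :: "nat \<Rightarrow> 'g \<Rightarrow> nat \<Rightarrow> nat"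
  assumes group: "group G" and countable: "countable (carrier G)"
    and compact: "compact_space X" and nonempty: "topspace X \<noteq> {}"
    and action: "group_action G (topspace X) \<alpha>"
    and homeo: "\<And>s. s \<in> carrier G \<Longrightarrow> homeomorphic_map X X (\<alpha> s)"
    and sofic: "sofic_approximation G d \<sigma>"
begin

abbreviation Maps :: "('x \<Rightarrow> 'x \<Rightarrow> real) \<Rightarrow> 'g set \<Rightarrow> real \<Rightarrow> nat \<Rightarrow> (nat \<Rightarrow> 'x) set" where
  "Maps \<rho> F \<delta> i \<equiv> approx_equivariant_maps X \<alpha> \<rho> F \<delta> (d i) (\<sigma> i)"

abbreviation windows :: "'g set set" where
  "windows \<equiv> {F. finite F \<and> F \<noteq> {} \<and> F \<subseteq> carrier G}"

abbreviation entropy :: "ereal \<Rightarrow> real \<Rightarrow> ('x \<Rightarrow> 'x \<Rightarrow> real) \<Rightarrow> ereal" where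
  "entropy \<equiv> sofic_entropy G X \<alpha> d \<sigma>"

abbreviation mdim :: "ereal \<Rightarrow> ('x \<Rightarrow> 'x \<Rightarrow> real) \<Rightarrow> ereal" where
  "mdim \<equiv> lower_sofic_mdim G X \<alpha> d \<sigma>"

lemma d_pos: "1 \<le> d i"
  using sofic by (simp add: sofic_approximation_def)

lemma sofic_permutes: "s \<in> carrier G \<Longrightarrow> \<sigma> i s permutes {1..d i}"
  using sofic by (auto simp: sofic_approximation_def sym_group_carrier Pi_iff)

lemma action_closed: "s \<in> carrier G \<Longrightarrow> x \<in> topspace X \<Longrightarrow> \<alpha> s x \<in> topspace X"
  using group_action.element_image[OF action] by blast

lemma action_one: "x \<in> topspace X \<Longrightarrow> \<alpha> \<one>\<^bsub>G\<^esub> x = x"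
  using group_action.id_eq_one[OF action] by (metis restrict_apply')

lemma Maps_range: "\<phi> \<in> Maps \<rho> F \<delta> i \<Longrightarrow> v \<in> {1..d i} \<Longrightarrow> \<phi> v \<in> topspace X"
  by (auto simp: approx_equivariant_maps_def)

lemma Maps_nonneg:
  assumes "continuous_pseudometric X \<rho>" "\<phi> \<in> Maps \<rho>' F \<delta> i" "\<psi> \<in> Maps \<rho>' F \<delta> i" "v \<in> {1..d i}"
  shows "0 \<le> \<rho> (\<phi> v) (\<psi> v)"
  using assms(2-) by (intro continuous_pseudometricD(1)[OF assms(1)] Maps_range)

lemma Maps_mono: "F \<subseteq> F' \<Longrightarrow> \<delta>' \<le> \<delta> \<Longrightarrow> Maps \<rho> F' \<delta>' i \<subseteq> Maps \<rho> F \<delta> i"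
  by (force simp: approx_equivariant_maps_def)

lemma entropy_mono:
  assumes "\<And>i F \<delta> \<phi> \<psi>. \<phi> \<in> Maps \<rho> F \<delta> i \<Longrightarrow> \<psi> \<in> Maps \<rho> F \<delta> i \<Longrightarrow> map_dist p (d i) \<rho> \<phi> \<psi> \<le> map_dist q (d i) \<rho> \<phi> \<psi>"
  shows "entropy p \<epsilon> \<rho> \<le> entropy q \<epsilon> \<rho>"
  unfolding sofic_entropy_def
  by (intro INF_mono' Limsup_mono always_eventually allI ereal_mult_left_mono elog_mono
      spanning_number_mono assms) auto

lemma mdim_mono:
  assumes "\<And>\<epsilon>. entropy p \<epsilon> \<rho> \<le> entropy q \<epsilon> \<rho>"
  shows "mdim p \<rho> \<le> mdim q \<rho>"
  unfolding lower_sofic_mdim_def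
proof (rule Liminf_mono)
  have "\<forall>\<^sub>F \<epsilon> in at_right (0::real). 0 < \<epsilon> \<and> \<epsilon> < 1"
    unfolding eventually_at_right_field by (intro exI[of _ 1]) simp
  then show "\<forall>\<^sub>F \<epsilon> in at_right 0. entropy p \<epsilon> \<rho> / ereal (ln (1 / \<epsilon>)) \<le> entropy q \<epsilon> \<rho> / ereal (ln (1 / \<epsilon>))"
    by eventually_elim (auto intro!: ereal_divide_right_mono assms)
qed

lemma mdim_1_le:
  assumes "continuous_pseudometric X \<rho>" "1 \<le> p"
  shows "mdim 1 \<rho> \<le> mdim p \<rho>"
  using Maps_nonneg[OF assms(1)] assms(2)
  by (intro mdim_mono entropy_mono map_dist_1_le d_pos) blast+

lemma mdim_le_infinity:
  assumes "continuous_pseudometric X \<rho>" "1 \<le> p"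
  shows "mdim p \<rho> \<le> mdim \<infinity> \<rho>"
  using Maps_nonneg[OF assms(1)] assms(2)
  by (intro mdim_mono entropy_mono map_dist_le_infinity d_pos) blast+

text \<open>
  Whether the value is \<open>-\<infinity>\<close> depends on the sets of maps only, and not on \<open>\<epsilon>\<close>: a nonempty set has
  spanning number at least \<open>1\<close> at every scale. Thus the entropy is either \<open>-\<infinity>\<close> for all \<open>\<epsilon>\<close> or
  nonnegative for all \<open>\<epsilon>\<close>.
\<close>

lemma mdim_minf_or_nonneg: "mdim p \<rho> = -\<infinity> \<or> 0 \<le> mdim p \<rho>"
proof -
  have small: "\<forall>\<^sub>F \<epsilon> in at_right (0::real). 0 < \<epsilon> \<and> \<epsilon> < 1"
    unfolding eventually_at_right_field by (intro exI[of _ 1]) simp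
  let ?t = "\<lambda>\<epsilon> F \<delta> i. ereal (1 / real (d i)) * elog (spanning_number \<epsilon> (Maps \<rho> F \<delta> i) (map_dist p (d i) \<rho>))"
  have d0: "0 < d i" for i using d_pos[of i] by linarith
  show ?thesis
  proof (cases "\<exists>F\<in>windows. \<exists>\<delta>>0. \<forall>\<^sub>F i in sequentially. Maps \<rho> F \<delta> i = {}")
    case True
    then obtain F \<delta> where F: "F \<in> windows" "0 < \<delta>" "\<forall>\<^sub>F i in sequentially. Maps \<rho> F \<delta> i = {}" by blast
    have "entropy p \<epsilon> \<rho> = -\<infinity>" for \<epsilon>
    proof -
      have "\<forall>\<^sub>F i in sequentially. ?t \<epsilon> F \<delta> i = -\<infinity>"
        using F(3)
      proof eventually_elim
        case (elim i)
        then have "spanning_number \<epsilon> (Maps \<rho> F \<delta> i) (map_dist p (d i) \<rho>) = 0"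
          by (simp add: spanning_number_eq_0_iff)
        then show ?case using d0[of i] by (simp add: elog_zero)
      qed
      then have "limsup (?t \<epsilon> F \<delta>) = limsup (\<lambda>i. -\<infinity>)" by (rule Limsup_eq)
      then have "limsup (?t \<epsilon> F \<delta>) = -\<infinity>" by (simp add: Limsup_const)
      moreover have "entropy p \<epsilon> \<rho> \<le> limsup (?t \<epsilon> F \<delta>)"
        unfolding sofic_entropy_def using F(1,2) by (intro INF_lower2[OF F(1)] INF_lower) auto
      ultimately show ?thesis by simp
    qed
    moreover from small have "\<forall>\<^sub>F \<epsilon> in at_right (0::real). -\<infinity> / ereal (ln (1 / \<epsilon>)) = -\<infinity>"
      by eventually_elim simp
    ultimately have "mdim p \<rho> = Liminf (at_right (0::real)) (\<lambda>\<epsilon>. -\<infinity>)"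
      unfolding lower_sofic_mdim_def by (intro Liminf_eq) simp
    then show ?thesis by (simp add: Liminf_const)
  next
    case False
    have "0 \<le> entropy p \<epsilon> \<rho>" for \<epsilon>
      unfolding sofic_entropy_def
    proof (intro INF_greatest, rule ccontr)
      fix F \<delta> assume F: "F \<in> windows" "\<delta> \<in> {0::real<..}" and "\<not> 0 \<le> limsup (?t \<epsilon> F \<delta>)"
      then have "\<forall>\<^sub>F i in sequentially. ?t \<epsilon> F \<delta> i < 0" by (intro Limsup_lessD) simp
      then have "\<forall>\<^sub>F i in sequentially. Maps \<rho> F \<delta> i = {}"
      proof eventually_elim
        case (elim i)
        then have "\<not> 0 \<le> elog (spanning_number \<epsilon> (Maps \<rho> F \<delta> i) (map_dist p (d i) \<rho>))"
          by (metis ereal_0_le_mult ereal_less_eq(5) not_le of_nat_0_le_iff zero_le_divide_1_iff)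
        then show ?case by (simp add: elog_nonneg_iff spanning_number_eq_0_iff)
      qed
      with False F show False by auto
    qed
    then have "0 \<le> mdim p \<rho>"
      unfolding lower_sofic_mdim_def
      by (intro Liminf_bounded eventually_mono[OF small]) (auto intro!: zero_le_divide_ereal)
    then show ?thesis ..
  qed
qed

end

section \<open>A tame compatible metric\<close>

text \<open>
  A generating pseudometric \<open>\<rho>\<close>, together with an enumeration \<open>a\<close> of the group and a \<open>\<rho>\<close>-dense
  sequence \<open>z\<close>. The \<open>n\<close>-th coordinate is \<open>\<rho> (a k x) (z j)\<close>, where \<open>(k, j)\<close> is the pair coded by \<open>n\<close>;
  \<open>shift n\<close> is the group element \<open>a k\<close>.
\<close>

locale orbit_coordinates = sofic_dynamics G X \<alpha> d \<sigma>
  for G :: "('g, 'm) monoid_scheme" and X :: "'x topology" and \<alpha> and d and \<sigma> +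
  fixes \<rho> :: "'x \<Rightarrow> 'x \<Rightarrow> real" and B :: real and a :: "nat \<Rightarrow> 'g" and z :: "nat \<Rightarrow> 'x"
  assumes pm: "continuous_pseudometric X \<rho>" and gen: "dynamically_generating G X \<alpha> \<rho>"
    and B_ge: "1 \<le> B" and B_bound: "\<And>x y. x \<in> topspace X \<Longrightarrow> y \<in> topspace X \<Longrightarrow> \<rho> x y \<le> B"
    and range_a: "range a = carrier G" and range_z: "range z \<subseteq> topspace X"
    and dense: "\<And>x \<kappa>. x \<in> topspace X \<Longrightarrow> 0 < \<kappa> \<Longrightarrow> \<exists>j. \<rho> x (z j) < \<kappa>"
begin

definition shift :: "nat \<Rightarrow> 'g" where
  "shift n = a (fst (prod_decode n))"

definition orbit_coord :: "nat \<Rightarrow> 'x \<Rightarrow> real" where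
  "orbit_coord n x = (if x \<in> topspace X then \<rho> (\<alpha> (shift n) x) (z (snd (prod_decode n))) else 0)"

lemma shift_closed: "shift n \<in> carrier G"
  using range_a by (auto simp: shift_def)

lemma z_closed: "z n \<in> topspace X"
  using range_z by auto

sublocale bounded_coordinates orbit_coord B
proof
  show "orbit_coord n x \<in> {0..B}" for n x
    using continuous_pseudometricD(1)[OF pm] B_bound B_ge action_closed shift_closed z_closed
    by (auto simp: orbit_coord_def)
qed (rule B_ge)

lemma orbit_coord_continuous: "continuous_map X euclideanreal (orbit_coord n)"
proof -
  have "continuous_map X euclideanreal ((\<lambda>x. \<rho> x (z (snd (prod_decode n)))) \<circ> \<alpha> (shift n))"
    by (rule continuous_map_compose[OF homeomorphic_imp_continuous_map[OF homeo[OF shift_closed]]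
        continuous_pseudometric_section[OF pm z_closed]])
  then show ?thesis by (rule continuous_map_eq) (simp add: orbit_coord_def)
qed

text \<open>
  If \<open>s\<close> is such that \<open>\<rho> (s x) (s y) > 0\<close>, then a point \<open>z j\<close> closer to \<open>s x\<close> than half of this
  distance is farther from \<open>s y\<close>.
\<close>

lemma orbit_coord_separates:
  assumes "x \<in> topspace X" "y \<in> topspace X" "x \<noteq> y"
  obtains n where "orbit_coord n x \<noteq> orbit_coord n y"
proof -
  obtain s where s: "s \<in> carrier G" "0 < \<rho> (\<alpha> s x) (\<alpha> s y)"
    using gen assms by (auto simp: dynamically_generating_def)
  then obtain k where k: "s = a k" using range_a by blast
  have in_X: "\<alpha> s x \<in> topspace X" "\<alpha> s y \<in> topspace X" using s assms action_closed by auto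
  then obtain j where j: "\<rho> (\<alpha> s x) (z j) < \<rho> (\<alpha> s x) (\<alpha> s y) / 2"
    using dense[of "\<alpha> s x" "\<rho> (\<alpha> s x) (\<alpha> s y) / 2"] s by auto
  have "\<rho> (\<alpha> s x) (\<alpha> s y) \<le> \<rho> (\<alpha> s x) (z j) + \<rho> (\<alpha> s y) (z j)"
    using continuous_pseudometricD(4)[OF pm in_X(1) z_closed in_X(2), of j]
      continuous_pseudometricD(3)[OF pm z_closed in_X(2), of j] by simp
  with j have "\<rho> (\<alpha> s x) (z j) < \<rho> (\<alpha> s y) (z j)" by simp
  then show ?thesis
    using assms by (intro that[of "prod_encode (k, j)"]) (simp add: orbit_coord_def shift_def k)
qed

lemma orbit_coord_lipschitz:
  assumes "x \<in> topspace X" "y \<in> topspace X"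
  shows "\<bar>orbit_coord n x - orbit_coord n y\<bar> \<le> \<rho> (\<alpha> (shift n) x) (\<alpha> (shift n) y)"
proof -
  let ?x = "\<alpha> (shift n) x" and ?y = "\<alpha> (shift n) y" and ?z = "z (snd (prod_decode n))"
  have in_X: "?x \<in> topspace X" "?y \<in> topspace X" "?z \<in> topspace X"
    using assms action_closed shift_closed z_closed by auto
  then have "\<rho> ?x ?z \<le> \<rho> ?x ?y + \<rho> ?y ?z" "\<rho> ?y ?z \<le> \<rho> ?x ?y + \<rho> ?x ?z"
    using continuous_pseudometricD(4)[OF pm, of ?x ?y ?z] continuous_pseudometricD(4)[OF pm, of ?y ?x ?z]
      continuous_pseudometricD(3)[OF pm, of ?x ?y] by auto
  then show ?thesis using assms by (auto simp: orbit_coord_def)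
qed

lemma coord_dist_pseudometric: "continuous_pseudometric X coord_dist"
  by (intro coord_dist_continuous_pseudometric orbit_coord_continuous)

lemma coord_dist_pos: "x \<in> topspace X \<Longrightarrow> y \<in> topspace X \<Longrightarrow> x \<noteq> y \<Longrightarrow> 0 < coord_dist x y"
  by (metis orbit_coord_separates coord_dist_separates)

lemma coord_dist_compatible: "compatible_metric X coord_dist"
  by (intro compatible_metric_of_separating_pseudometric coord_dist_pseudometric compact
      coord_dist_pos coord_dist_sym coord_dist_nonneg)

lemma coord_dist_tame: "tame_growth X coord_dist"
  unfolding tame_growth_def
proof (intro allI impI)
  fix b :: real assume "0 < b"
  let ?e = "\<lambda>\<epsilon>. ereal (\<epsilon> powr b) * elog (spanning_number \<epsilon> (topspace X) coord_dist)"
  have lim: "((\<lambda>\<epsilon>. \<epsilon> powr b * code_bound \<epsilon>) \<longlongrightarrow> 0) (at_right 0)"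
    unfolding code_bound_def using B_ge \<open>0 < b\<close> by real_asymp
  have small: "\<forall>\<^sub>F \<epsilon> in at_right (0::real). 0 < \<epsilon> \<and> \<epsilon> < 1"
    unfolding eventually_at_right_field by (intro exI[of _ 1]) simp
  show "(?e \<longlongrightarrow> 0) (at_right 0)"
  proof (rule tendsto_sandwich)
    show "\<forall>\<^sub>F \<epsilon> in at_right 0. 0 \<le> ?e \<epsilon>"
    proof (intro always_eventually allI ereal_0_le_mult)
      fix \<epsilon> :: real
      have "spanning_number \<epsilon> (topspace X) coord_dist \<noteq> 0"
        using nonempty unfolding spanning_number_eq_0_iff .
      then show "0 \<le> elog (spanning_number \<epsilon> (topspace X) coord_dist)"
        unfolding elog_nonneg_iff .
    qed simp
    show "\<forall>\<^sub>F \<epsilon> in at_right 0. ?e \<epsilon> \<le> ereal (\<epsilon> powr b * code_bound \<epsilon>)"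
      using small
    proof eventually_elim
      case (elim \<epsilon>)
      then obtain c :: "'x \<Rightarrow> nat \<Rightarrow> nat" and T
        where T: "finite T" "range c \<subseteq> T" "T \<noteq> {}" "ln (real (card T)) \<le> code_bound \<epsilon>"
          and c: "\<And>x y. c x = c y \<Longrightarrow> coord_dist x y < \<epsilon>"
        using coord_dist_code by metis
      have "spanning_number \<epsilon> (topspace X) coord_dist \<le> enat (card T)"
        using T(2) by (intro spanning_number_le_code[OF T(1), of c] c) auto
      then have "elog (spanning_number \<epsilon> (topspace X) coord_dist) \<le> elog (enat (card T))"
        by (rule elog_mono)
      also have "\<dots> = ereal (ln (real (card T)))"
        using T(1,3) by (simp add: elog_def)
      also have "\<dots> \<le> ereal (code_bound \<epsilon>)" using T(4) by simp
      finally have "?e \<epsilon> \<le> ereal (\<epsilon> powr b) * ereal (code_bound \<epsilon>)"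
        by (rule ereal_mult_left_mono) simp
      then show ?case by simp
    qed
    show "((\<lambda>\<epsilon>. ereal (\<epsilon> powr b * code_bound \<epsilon>)) \<longlongrightarrow> 0) (at_right 0)"
      using tendsto_ereal[OF lim] by (simp add: zero_ereal_def)
  qed simp
qed

section \<open>Almost equivariant maps seen by the tame metric\<close>

text \<open>
  Write \<open>D\<close> for \<open>coord_dist\<close>. By compactness, \<open>\<rho> < \<kappa>\<close> wherever \<open>D < \<tau>\<close>, and elsewhere \<open>\<rho> \<le> B \<le> (B/\<tau>) D\<close>.
  The resulting
  pointwise inequality \<open>\<rho>\<^sup>2 \<le> \<kappa>\<^sup>2 + (B/\<tau>)\<^sup>2 D\<^sup>2\<close> passes to averages, so a map which is almost
  equivariant in mean square for \<open>D\<close> is so for \<open>\<rho>\<close>.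
\<close>

lemma coord_dist_Maps_subset:
  assumes "0 < \<delta>" "F \<subseteq> carrier G"
  obtains \<delta>' where "0 < \<delta>'" "\<And>i. Maps coord_dist F \<delta>' i \<subseteq> Maps \<rho> F \<delta> i"
proof -
  define \<kappa> where "\<kappa> = \<delta> / 2"
  have "0 < \<kappa>" using assms by (simp add: \<kappa>_def)
  then obtain \<tau> where \<tau>: "0 < \<tau>"
    "\<And>x y. x \<in> topspace X \<Longrightarrow> y \<in> topspace X \<Longrightarrow> coord_dist x y < \<tau> \<Longrightarrow> \<rho> x y < \<kappa>"
    using separating_pseudometric_controls[OF pm coord_dist_pseudometric compact coord_dist_pos] by metis
  define c where "c = B / \<tau>"
  have "0 < c" using \<tau> B_ge by (simp add: c_def)
  have pointwise: "(\<rho> x y)\<^sup>2 \<le> \<kappa>\<^sup>2 + c\<^sup>2 * (coord_dist x y)\<^sup>2"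
    if "x \<in> topspace X" "y \<in> topspace X" for x y
  proof (cases "coord_dist x y < \<tau>")
    case True
    then have "(\<rho> x y)\<^sup>2 \<le> \<kappa>\<^sup>2"
      using \<tau>(2)[of x y] that continuous_pseudometricD(1)[OF pm, of x y] by (intro power_mono) auto
    then show ?thesis by (simp add: add_increasing2)
  next
    case False
    then have "B \<le> c * coord_dist x y" using \<tau>(1) B_ge by (simp add: c_def field_simps)
    then have "(\<rho> x y)\<^sup>2 \<le> (c * coord_dist x y)\<^sup>2"
      using B_bound[of x y] that continuous_pseudometricD(1)[OF pm, of x y] by (intro power_mono) auto
    then show ?thesis by (simp add: power_mult_distrib add_increasing)
  qed
  have "Maps coord_dist F (\<kappa> / c) i \<subseteq> Maps \<rho> F \<delta> i" for i
  proof
    fix \<phi> assume \<phi>: "\<phi> \<in> Maps coord_dist F (\<kappa> / c) i"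
    have "map_dist 2 (d i) \<rho> (\<phi> \<circ> \<sigma> i s) (\<lambda>v. \<alpha> s (\<phi> v)) < \<delta>" if "s \<in> F" for s
    proof -
      let ?f = "\<phi> \<circ> \<sigma> i s" and ?g = "\<lambda>v. \<alpha> s (\<phi> v)"
      have s: "s \<in> carrier G" using that assms(2) by blast
      have fX: "?f v \<in> topspace X" and gX: "?g v \<in> topspace X" if "v \<in> {1..d i}" for v
        using Maps_range[OF \<phi>] permutes_in_image[OF sofic_permutes[OF s], of i v] action_closed[OF s] that
        by (simp_all del: atLeastAtMost_iff)
      have "map_dist 2 (d i) coord_dist ?f ?g < \<kappa> / c"
        using \<phi> that by (simp add: approx_equivariant_maps_def)
      moreover have "map_dist 2 (d i) coord_dist ?f ?g
          = sqrt ((\<Sum>v=1..d i. (coord_dist (?f v) (?g v))\<^sup>2) / real (d i))"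
        by (rule map_dist_2) (rule coord_dist_nonneg)
      ultimately have "(\<Sum>v=1..d i. (coord_dist (?f v) (?g v))\<^sup>2) / real (d i) < (\<kappa> / c)\<^sup>2"
        using real_sqrt_less_iff[of _ "(\<kappa> / c)\<^sup>2"] \<open>0 < c\<close> \<open>0 < \<kappa>\<close> by simp
      then have small: "c\<^sup>2 * ((\<Sum>v=1..d i. (coord_dist (?f v) (?g v))\<^sup>2) / real (d i)) < \<kappa>\<^sup>2"
        using \<open>0 < c\<close> by (simp add: power_divide field_simps)
      have "(\<Sum>v=1..d i. (\<rho> (?f v) (?g v))\<^sup>2) / real (d i)
          \<le> (\<Sum>v=1..d i. \<kappa>\<^sup>2 + c\<^sup>2 * (coord_dist (?f v) (?g v))\<^sup>2) / real (d i)"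
        using pointwise fX gX by (intro divide_right_mono sum_mono) auto
      also have "\<dots> = \<kappa>\<^sup>2 + c\<^sup>2 * ((\<Sum>v=1..d i. (coord_dist (?f v) (?g v))\<^sup>2) / real (d i))"
        using d_pos[of i] by (simp add: sum.distrib add_divide_distrib flip: sum_distrib_left)
      also have "\<dots> < \<kappa>\<^sup>2 + \<kappa>\<^sup>2" using small by simp
      also have "\<dots> \<le> \<delta>\<^sup>2" by (simp add: \<kappa>_def power_divide)
      finally have "sqrt ((\<Sum>v=1..d i. (\<rho> (?f v) (?g v))\<^sup>2) / real (d i)) < \<delta>"
        using assms(1) by (intro real_less_lsqrt) auto
      moreover have "map_dist 2 (d i) \<rho> ?f ?g
          = sqrt ((\<Sum>v=1..d i. (\<rho> (?f v) (?g v))\<^sup>2) / real (d i))"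
        using fX gX by (intro map_dist_2 continuous_pseudometricD(1)[OF pm])
      ultimately show ?thesis by simp
    qed
    then show "\<phi> \<in> Maps \<rho> F \<delta> i"
      using \<phi> by (simp add: approx_equivariant_maps_def)
  qed
  then show ?thesis using \<open>0 < \<kappa>\<close> \<open>0 < c\<close> by (intro that[of "\<kappa> / c"]) auto
qed

text \<open>
  Translating by \<open>s\<close> is replaced by the permutation \<open>\<sigma> i s\<close>, at the cost of \<open>\<delta>\<close> for each of the two
  maps, and the permutation only rearranges the sum.
\<close>

lemma average_shifted_le:
  assumes \<phi>: "\<phi> \<in> Maps \<rho> F \<delta> i" and \<psi>: "\<psi> \<in> Maps \<rho> F \<delta> i" and s: "s \<in> F" "s \<in> carrier G"
  shows "(\<Sum>v=1..d i. \<rho> (\<alpha> s (\<phi> v)) (\<alpha> s (\<psi> v))) / real (d i) \<le> map_dist 1 (d i) \<rho> \<phi> \<psi> + 2 * \<delta>"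
proof -
  let ?p = "\<sigma> i s"
  have p: "?p permutes {1..d i}" by (rule sofic_permutes[OF s(2)])
  note D = continuous_pseudometricD[OF pm]
  have \<phi>X: "\<phi> (?p v) \<in> topspace X" "\<alpha> s (\<phi> v) \<in> topspace X"
    and \<psi>X: "\<psi> (?p v) \<in> topspace X" "\<alpha> s (\<psi> v) \<in> topspace X" if "v \<in> {1..d i}" for v
    using Maps_range[OF \<phi>] Maps_range[OF \<psi>] permutes_in_image[OF p, of v] action_closed[OF s(2)] that
    by (simp_all del: atLeastAtMost_iff)
  have err: "(\<Sum>v=1..d i. \<rho> (\<omega> (?p v)) (\<alpha> s (\<omega> v))) / real (d i) \<le> \<delta>" if \<omega>: "\<omega> \<in> Maps \<rho> F \<delta> i" for \<omega>
  proof -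
    have nn: "0 \<le> \<rho> ((\<omega> \<circ> ?p) v) (\<alpha> s (\<omega> v))" if "v \<in> {1..d i}" for v
      using Maps_range[OF \<omega>] permutes_in_image[OF p, of v] action_closed[OF s(2)] that
      by (intro D(1)) (simp_all del: atLeastAtMost_iff)
    have "(\<Sum>v=1..d i. \<rho> ((\<omega> \<circ> ?p) v) (\<alpha> s (\<omega> v))) / real (d i) = map_dist 1 (d i) \<rho> (\<omega> \<circ> ?p) (\<lambda>v. \<alpha> s (\<omega> v))"
      using nn by (intro map_dist_1[symmetric])
    also have "\<dots> \<le> map_dist 2 (d i) \<rho> (\<omega> \<circ> ?p) (\<lambda>v. \<alpha> s (\<omega> v))"
      using nn by (intro map_dist_1_le d_pos) auto
    also have "\<dots> \<le> \<delta>" using \<omega> s(1) by (auto simp: approx_equivariant_maps_def)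
    finally show ?thesis by simp
  qed
  have "\<rho> (\<alpha> s (\<phi> v)) (\<alpha> s (\<psi> v)) \<le> \<rho> (\<phi> (?p v)) (\<alpha> s (\<phi> v)) + \<rho> (\<phi> (?p v)) (\<psi> (?p v)) + \<rho> (\<psi> (?p v)) (\<alpha> s (\<psi> v))"
    if v: "v \<in> {1..d i}" for v
    using D(4)[OF \<phi>X(2)[OF v] \<phi>X(1)[OF v] \<psi>X(2)[OF v]] D(4)[OF \<phi>X(1)[OF v] \<psi>X(1)[OF v] \<psi>X(2)[OF v]]
      D(3)[OF \<phi>X(2)[OF v] \<phi>X(1)[OF v]] by linarith
  then have "(\<Sum>v=1..d i. \<rho> (\<alpha> s (\<phi> v)) (\<alpha> s (\<psi> v)))
      \<le> (\<Sum>v=1..d i. \<rho> (\<phi> (?p v)) (\<alpha> s (\<phi> v))) + (\<Sum>v=1..d i. \<rho> (\<phi> (?p v)) (\<psi> (?p v)))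
        + (\<Sum>v=1..d i. \<rho> (\<psi> (?p v)) (\<alpha> s (\<psi> v)))"
    by (simp only: sum.distrib[symmetric]) (rule sum_mono)
  also have "(\<Sum>v=1..d i. \<rho> (\<phi> (?p v)) (\<psi> (?p v))) = (\<Sum>v=1..d i. \<rho> (\<phi> v) (\<psi> v))"
    using sum.permute[OF p, of "\<lambda>v. \<rho> (\<phi> v) (\<psi> v)"] by (simp add: o_def)
  finally have "(\<Sum>v=1..d i. \<rho> (\<alpha> s (\<phi> v)) (\<alpha> s (\<psi> v))) / real (d i)
      \<le> (\<Sum>v=1..d i. \<rho> (\<phi> (?p v)) (\<alpha> s (\<phi> v))) / real (d i) + (\<Sum>v=1..d i. \<rho> (\<phi> v) (\<psi> v)) / real (d i)
        + (\<Sum>v=1..d i. \<rho> (\<psi> (?p v)) (\<alpha> s (\<psi> v))) / real (d i)"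
    by (simp add: divide_right_mono flip: add_divide_distrib)
  moreover have "(\<Sum>v=1..d i. \<rho> (\<phi> v) (\<psi> v)) / real (d i) = map_dist 1 (d i) \<rho> \<phi> \<psi>"
    using Maps_nonneg[OF pm \<phi> \<psi>] by (intro map_dist_1[symmetric])
  ultimately show ?thesis using err[OF \<phi>] err[OF \<psi>] by linarith
qed

lemma average_coord_dist_le:
  assumes \<phi>: "\<phi> \<in> Maps \<rho> F \<delta> i" and \<psi>: "\<psi> \<in> Maps \<rho> F \<delta> i" and F: "shift ` {..<N} \<subseteq> F" and \<delta>: "0 \<le> \<delta>"
  shows "(\<Sum>v=1..d i. coord_dist (\<phi> v) (\<psi> v)) / real (d i) \<le> map_dist 1 (d i) \<rho> \<phi> \<psi> + 2 * \<delta> + B / 2 ^ N"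
proof -
  let ?A = "\<lambda>n. (\<Sum>v=1..d i. \<rho> (\<alpha> (shift n) (\<phi> v)) (\<alpha> (shift n) (\<psi> v))) / real (d i)"
  let ?c = "map_dist 1 (d i) \<rho> \<phi> \<psi> + 2 * \<delta>"
  have d0: "0 < real (d i)" using d_pos[of i] by simp
  have "map_dist 1 (d i) \<rho> \<phi> \<psi> = (\<Sum>v=1..d i. \<rho> (\<phi> v) (\<psi> v)) / real (d i)"
    using Maps_nonneg[OF pm \<phi> \<psi>] by (intro map_dist_1)
  moreover have "0 \<le> (\<Sum>v=1..d i. \<rho> (\<phi> v) (\<psi> v))"
    using Maps_nonneg[OF pm \<phi> \<psi>] by (rule sum_nonneg)
  ultimately have c: "0 \<le> ?c" using \<delta> by simp
  have "(\<Sum>v=1..d i. coord_dist (\<phi> v) (\<psi> v))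
      \<le> (\<Sum>v=1..d i. (\<Sum>n<N. \<rho> (\<alpha> (shift n) (\<phi> v)) (\<alpha> (shift n) (\<psi> v)) / 2 ^ Suc n) + B / 2 ^ N)"
  proof (rule sum_mono)
    fix v assume v: "v \<in> {1..d i}"
    have "coord_dist (\<phi> v) (\<psi> v) \<le> (\<Sum>n<N. \<bar>orbit_coord n (\<phi> v) - orbit_coord n (\<psi> v)\<bar> / 2 ^ Suc n) + B / 2 ^ N"
      by (rule coord_dist_truncation)
    also have "(\<Sum>n<N. \<bar>orbit_coord n (\<phi> v) - orbit_coord n (\<psi> v)\<bar> / 2 ^ Suc n)
        \<le> (\<Sum>n<N. \<rho> (\<alpha> (shift n) (\<phi> v)) (\<alpha> (shift n) (\<psi> v)) / 2 ^ Suc n)"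
      by (intro sum_mono divide_right_mono orbit_coord_lipschitz Maps_range[OF \<phi> v] Maps_range[OF \<psi> v]) simp
    finally show "coord_dist (\<phi> v) (\<psi> v)
        \<le> (\<Sum>n<N. \<rho> (\<alpha> (shift n) (\<phi> v)) (\<alpha> (shift n) (\<psi> v)) / 2 ^ Suc n) + B / 2 ^ N" by simp
  qed
  also have "\<dots> = (\<Sum>n<N. (\<Sum>v=1..d i. \<rho> (\<alpha> (shift n) (\<phi> v)) (\<alpha> (shift n) (\<psi> v))) / 2 ^ Suc n) + real (d i) * (B / 2 ^ N)"
    by (simp only: sum.distrib sum_divide_distrib) (subst sum.swap, simp)
  finally have "(\<Sum>v=1..d i. coord_dist (\<phi> v) (\<psi> v)) / real (d i)
      \<le> ((\<Sum>n<N. (\<Sum>v=1..d i. \<rho> (\<alpha> (shift n) (\<phi> v)) (\<alpha> (shift n) (\<psi> v))) / 2 ^ Suc n) + real (d i) * (B / 2 ^ N)) / real (d i)"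
    by (rule divide_right_mono) simp
  also have "\<dots> = (\<Sum>n<N. ?A n / 2 ^ Suc n) + B / 2 ^ N"
    using d0 by (simp add: add_divide_distrib sum_divide_distrib[of _ "{..<N}"] divide_divide_eq_left mult.commute)
  also have "(\<Sum>n<N. ?A n / 2 ^ Suc n) \<le> (\<Sum>n<N. ?c * (1/2) ^ Suc n)"
  proof (rule sum_mono)
    fix n assume "n \<in> {..<N}"
    then have "?A n \<le> ?c" using F by (intro average_shifted_le[OF \<phi> \<psi>] shift_closed) auto
    then have "?A n / 2 ^ Suc n \<le> ?c / 2 ^ Suc n" by (rule divide_right_mono) simp
    then show "?A n / 2 ^ Suc n \<le> ?c * (1/2) ^ Suc n" by (simp add: power_divide)
  qed
  also have "\<dots> = ?c * (\<Sum>n<N. (1/2) ^ Suc n)" by (rule sum_distrib_left[symmetric])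
  also have "\<dots> \<le> ?c"
    using sum_le_suminf[OF sums_summable[OF power_half_series], of "{..<N}"]
      sums_unique[OF power_half_series] c by (intro mult_left_le) simp_all
  finally show ?thesis by simp
qed

text \<open>
  The new window contains the group elements \<open>shift n\<close> of the finitely many coordinates that count
  at scale \<open>\<epsilon>\<close>. Two maps near the same spanning map are \<open>2\<epsilon>\<close>-close for the average of \<open>\<rho>\<close>; the
  defects of equivariance and the tail of the series add at most \<open>\<epsilon>/2\<close> each, so that the average of
  \<open>coord_dist\<close> is at most \<open>3\<epsilon>\<close>.
\<close>

lemma spanning_number_Maps_le:
  assumes r: "0 < r" "r < 1" and \<epsilon>: "0 < \<epsilon>" and F: "F \<in> windows" and \<delta>: "0 < \<delta>"
  obtains F' \<delta>' where "F' \<in> windows" "0 < \<delta>'"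
    "\<And>i. ereal (1 / real (d i)) *
           elog (spanning_number (2 * r) (Maps coord_dist F' \<delta>' i) (map_dist \<infinity> (d i) coord_dist))
       \<le> ereal (1 / real (d i)) *
           elog (spanning_number \<epsilon> (Maps \<rho> F \<delta> i) (map_dist 1 (d i) \<rho>))
         + ereal (ln 2 + 3 * \<epsilon> / r * code_bound r)"
proof -
  have "(\<lambda>N. B / 2 ^ N) \<longlonglongrightarrow> 0" by real_asymp
  then have "\<forall>\<^sub>F N in sequentially. B / 2 ^ N < \<epsilon> / 2"
    by (rule order_tendstoD(2)) (use \<epsilon> in simp)
  then obtain N where N: "B / 2 ^ N < \<epsilon> / 2" by (auto simp: eventually_sequentially)
  define F' where "F' = F \<union> shift ` {..<N}"
  \<comment> \<open>The two defects of equivariance contribute \<open>2 * \<delta>1 \<le> \<epsilon> / 2\<close> to the average below.\<close>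
  define \<delta>1 where "\<delta>1 = min \<delta> (\<epsilon> / 4)"
  have F': "F' \<in> windows" using F shift_closed by (auto simp: F'_def)
  have \<delta>1: "0 < \<delta>1" "\<delta>1 \<le> \<epsilon> / 4" using \<delta> \<epsilon> by (auto simp: \<delta>1_def)
  obtain \<delta>' where \<delta>': "0 < \<delta>'" "\<And>i. Maps coord_dist F' \<delta>' i \<subseteq> Maps \<rho> F' \<delta>1 i"
    using coord_dist_Maps_subset[OF \<delta>1(1), of F'] F' by blast
  obtain c :: "'x \<Rightarrow> nat \<Rightarrow> nat" and T
    where T: "finite T" "range c \<subseteq> T" "T \<noteq> {}" "ln (real (card T)) \<le> code_bound r"
      and c: "\<And>x y. c x = c y \<Longrightarrow> coord_dist x y < r"
    using coord_dist_code[OF r] by metis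
  have K: "1 \<le> card T" using T by (simp add: Suc_le_eq card_gt_0_iff)
  show ?thesis
  proof (rule that[OF F' \<delta>'(1)])
    fix i
    let ?S' = "spanning_number (2 * r) (Maps coord_dist F' \<delta>' i) (map_dist \<infinity> (d i) coord_dist)"
    let ?S = "spanning_number \<epsilon> (Maps \<rho> F \<delta> i) (map_dist 1 (d i) \<rho>)"
    define m where "m = nat \<lfloor>3 * \<epsilon> / r * real (d i)\<rfloor>"
    define M where "M = 2 ^ d i * card T ^ m"
    have sub: "Maps coord_dist F' \<delta>' i \<subseteq> Maps \<rho> F \<delta> i"
    proof -
      have "Maps \<rho> F' \<delta>1 i \<subseteq> Maps \<rho> F \<delta> i"
        by (rule Maps_mono) (auto simp: F'_def \<delta>1_def)
      with \<delta>'(2)[of i] show ?thesis by blast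
    qed
    have d0: "0 < real (d i)" using d_pos[of i] by simp
    have "?S' \<le> ?S * enat (2 ^ d i * card T ^ nat \<lfloor>3 * \<epsilon> / r * real (d i)\<rfloor>)"
    proof (rule spanning_number_uniform_le[OF d_pos r(1) coord_dist_nonneg coord_dist_sym
          coord_dist_triangle T(1-3) c sub])
      fix \<phi> \<psi> \<omega>
      assume \<phi>: "\<phi> \<in> Maps coord_dist F' \<delta>' i" and \<psi>: "\<psi> \<in> Maps coord_dist F' \<delta>' i"
        and \<omega>: "\<omega> \<in> Maps \<rho> F \<delta> i"
        and near: "map_dist 1 (d i) \<rho> \<omega> \<phi> < \<epsilon>" "map_dist 1 (d i) \<rho> \<omega> \<psi> < \<epsilon>"
      note in_F = subsetD[OF sub \<phi>] subsetD[OF sub \<psi>]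
      note D = continuous_pseudometricD[OF pm]
      have eq: "map_dist 1 (d i) \<rho> \<mu> \<nu> = (\<Sum>v=1..d i. \<rho> (\<mu> v) (\<nu> v)) / real (d i)"
        if "\<mu> \<in> Maps \<rho> F \<delta> i" "\<nu> \<in> Maps \<rho> F \<delta> i" for \<mu> \<nu>
        using Maps_nonneg[OF pm that] by (rule map_dist_1)
      have "(\<Sum>v=1..d i. \<rho> (\<phi> v) (\<psi> v)) \<le> (\<Sum>v=1..d i. \<rho> (\<omega> v) (\<phi> v) + \<rho> (\<omega> v) (\<psi> v))"
      proof (rule sum_mono)
        fix v assume v: "v \<in> {1..d i}"
        show "\<rho> (\<phi> v) (\<psi> v) \<le> \<rho> (\<omega> v) (\<phi> v) + \<rho> (\<omega> v) (\<psi> v)"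
          using D(4)[OF Maps_range[OF in_F(1) v] Maps_range[OF \<omega> v] Maps_range[OF in_F(2) v]]
            D(3)[OF Maps_range[OF in_F(1) v] Maps_range[OF \<omega> v]] by simp
      qed
      then have "map_dist 1 (d i) \<rho> \<phi> \<psi> \<le> map_dist 1 (d i) \<rho> \<omega> \<phi> + map_dist 1 (d i) \<rho> \<omega> \<psi>"
        using eq \<omega> in_F by (simp add: sum.distrib divide_right_mono flip: add_divide_distrib)
      moreover have "(\<Sum>v=1..d i. coord_dist (\<phi> v) (\<psi> v)) / real (d i)
          \<le> map_dist 1 (d i) \<rho> \<phi> \<psi> + 2 * \<delta>1 + B / 2 ^ N"
        using \<phi> \<psi> \<delta>'(2)[of i] \<delta>1(1)
        by (intro average_coord_dist_le[where F=F']) (auto simp: F'_def)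
      ultimately show "(\<Sum>v=1..d i. coord_dist (\<phi> v) (\<psi> v)) / real (d i) \<le> 3 * \<epsilon>"
        using near N \<delta>1(2) by linarith
    qed
    then have "elog ?S' \<le> elog (?S * enat M)" by (intro elog_mono) (simp add: M_def m_def)
    also have "\<dots> \<le> elog ?S + ereal (ln (real M))"
      using K by (intro elog_times_le) (simp add: M_def Suc_le_eq)
    finally have "ereal (1 / real (d i)) * elog ?S' \<le> ereal (1 / real (d i)) * (elog ?S + ereal (ln (real M)))"
      by (rule ereal_mult_left_mono) simp
    also have "\<dots> = ereal (1 / real (d i)) * elog ?S + ereal (ln (real M) / real (d i))"
      using d0 by (cases "elog ?S") (auto simp: field_simps)
    also have "ln (real M) / real (d i) \<le> ln 2 + 3 * \<epsilon> / r * code_bound r"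
    proof -
      have "ln (real M) = real (d i) * ln 2 + real m * ln (real (card T))"
        using K by (simp add: M_def ln_mult ln_realpow)
      moreover have "real m \<le> 3 * \<epsilon> / r * real (d i)"
        using \<epsilon> r by (simp add: m_def)
      then have "real m * ln (real (card T)) \<le> 3 * \<epsilon> / r * real (d i) * code_bound r"
        using T(4) K \<epsilon> r by (intro mult_mono) auto
      ultimately have "ln (real M) \<le> real (d i) * (ln 2 + 3 * \<epsilon> / r * code_bound r)"
        by (simp add: algebra_simps)
      then show ?thesis using d0 by (simp add: pos_divide_le_eq mult.commute)
    qed
    finally show "ereal (1 / real (d i)) * elog ?S'
        \<le> ereal (1 / real (d i)) * elog ?S + ereal (ln 2 + 3 * \<epsilon> / r * code_bound r)"
      by (simp add: add_left_mono)
  qed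
qed

lemma entropy_coord_dist_le:
  assumes "0 < r" "r < 1" "0 < \<epsilon>"
  shows "entropy \<infinity> (2 * r) coord_dist \<le> entropy 1 \<epsilon> \<rho> + ereal (ln 2 + 3 * \<epsilon> / r * code_bound r)"
proof -
  let ?C = "ereal (ln 2 + 3 * \<epsilon> / r * code_bound r)"
  let ?t = "\<lambda>F \<delta> i. ereal (1 / real (d i)) * elog (spanning_number \<epsilon> (Maps \<rho> F \<delta> i) (map_dist 1 (d i) \<rho>))"
  let ?t' = "\<lambda>F \<delta> i. ereal (1 / real (d i)) *
      elog (spanning_number (2 * r) (Maps coord_dist F \<delta> i) (map_dist \<infinity> (d i) coord_dist))"
  have "entropy \<infinity> (2 * r) coord_dist - ?C \<le> entropy 1 \<epsilon> \<rho>"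
    unfolding sofic_entropy_def[of _ _ _ _ _ 1]
  proof (intro INF_greatest)
    fix F \<delta> assume "F \<in> windows" "\<delta> \<in> {0::real<..}"
    then obtain F' \<delta>' where *: "F' \<in> windows" "0 < \<delta>'" "\<And>i. ?t' F' \<delta>' i \<le> ?t F \<delta> i + ?C"
      using spanning_number_Maps_le[OF assms, of F \<delta>] by auto
    have "entropy \<infinity> (2 * r) coord_dist \<le> limsup (?t' F' \<delta>')"
      unfolding sofic_entropy_def using *(1,2) by (intro INF_lower2[OF *(1)] INF_lower) auto
    also have "\<dots> \<le> limsup (\<lambda>i. ?t F \<delta> i + ?C)"
      using *(3) by (intro Limsup_mono) simp
    also have "\<dots> = limsup (?t F \<delta>) + ?C"
      by (rule Limsup_add_ereal_right) auto
    finally show "entropy \<infinity> (2 * r) coord_dist - ?C \<le> limsup (?t F \<delta>)"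
      by (subst ereal_minus_le) auto
  qed
  then show ?thesis by (subst (asm) ereal_minus_le) auto
qed

text \<open>
  The choice \<open>r = \<epsilon> log\<^sup>3 (1/\<epsilon>)\<close> balances two demands: the fraction \<open>3\<epsilon>/r\<close> of exceptional places must
  beat \<open>code_bound r\<close>, which is of order \<open>log\<^sup>2 (1/r)\<close>, and \<open>log (1/r)\<close> must remain asymptotic to
  \<open>log (1/\<epsilon>)\<close>.
\<close>

lemma mdim_coord_dist_le: "mdim \<infinity> coord_dist \<le> mdim 1 \<rho>"
proof -
  define r where "r \<epsilon> = \<epsilon> * ln (1 / \<epsilon>) ^ 3" for \<epsilon> :: real
  define c where "c \<epsilon> = ln 2 + 3 * \<epsilon> / r \<epsilon> * code_bound (r \<epsilon>)" for \<epsilon>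
  show ?thesis
    unfolding lower_sofic_mdim_def
  proof (rule Liminf_divide_ln_reparametrized[where \<theta>="\<lambda>\<epsilon>. 2 * r \<epsilon>" and c=c])
    have small: "\<forall>\<^sub>F \<epsilon> in at_right (0::real). 0 < \<epsilon>"
      unfolding eventually_at_right_field by (intro exI[of _ 1]) simp
    have "\<forall>\<^sub>F \<epsilon> in at_right (0::real). 0 < r \<epsilon>" "\<forall>\<^sub>F \<epsilon> in at_right (0::real). r \<epsilon> < 1"
      unfolding r_def by real_asymp+
    with small show "\<forall>\<^sub>F \<epsilon> in at_right 0. entropy \<infinity> (2 * r \<epsilon>) coord_dist \<le> entropy 1 \<epsilon> \<rho> + ereal (c \<epsilon>)"
      unfolding c_def by eventually_elim (rule entropy_coord_dist_le)
    show "filterlim (\<lambda>\<epsilon>. 2 * r \<epsilon>) (at_right 0) (at_right 0)"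
      unfolding r_def by real_asymp
    show "((\<lambda>\<epsilon>. c \<epsilon> / ln (1 / (2 * r \<epsilon>))) \<longlongrightarrow> 0) (at_right 0)"
      unfolding c_def r_def code_bound_def using B_ge by real_asymp
    show "((\<lambda>\<epsilon>. ln (1 / \<epsilon>) / ln (1 / (2 * r \<epsilon>))) \<longlongrightarrow> 1) (at_right 0)"
      unfolding r_def by real_asymp
  qed
qed

end

section \<open>Comparing the infima\<close>

context sofic_dynamics
begin

lemma tame_metric_below_pseudometric:
  assumes \<rho>: "continuous_pseudometric X \<rho>" and gen: "dynamically_generating G X \<alpha> \<rho>"
  obtains D where "compatible_metric X D" "tame_growth X D" "mdim \<infinity> D \<le> mdim 1 \<rho>"
proof -
  obtain B where B: "1 \<le> B" "\<And>x y. x \<in> topspace X \<Longrightarrow> y \<in> topspace X \<Longrightarrow> \<rho> x y \<le> B"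
    using continuous_pseudometric_bounded[OF \<rho> compact] by blast
  obtain z :: "nat \<Rightarrow> 'x" where z: "range z \<subseteq> topspace X"
    "\<And>x \<kappa>. x \<in> topspace X \<Longrightarrow> 0 < \<kappa> \<Longrightarrow> \<exists>j. \<rho> x (z j) < \<kappa>"
    using continuous_pseudometric_dense_sequence[OF \<rho> compact nonempty] by blast
  have "carrier G \<noteq> {}" using group.is_monoid[OF group] monoid.one_closed by blast
  then have "range (from_nat_into (carrier G)) = carrier G"
    using countable by (rule range_from_nat_into)
  then interpret O: orbit_coordinates G X \<alpha> d \<sigma> \<rho> B "from_nat_into (carrier G)" z
    using \<rho> gen B z by unfold_locales auto
  show ?thesis
    using that O.coord_dist_compatible O.coord_dist_tame O.mdim_coord_dist_le by blast
qed

lemma compatible_metric_generating: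
  assumes "compatible_metric X \<rho>"
  shows "dynamically_generating G X \<alpha> \<rho>"
  unfolding dynamically_generating_def
proof (intro ballI impI)
  fix x y assume xy: "x \<in> topspace X" "y \<in> topspace X" "x \<noteq> y"
  interpret M: Metric_space "topspace X" \<rho> using assms by (simp add: compatible_metric_def)
  have "0 < \<rho> x y" using xy by simp
  then show "\<exists>s\<in>carrier G. 0 < \<rho> (\<alpha> s x) (\<alpha> s y)"
    using action_one xy monoid.one_closed[OF group.is_monoid[OF group]] by metis
qed

lemma sofic_metric_mdim_minf_or_nonneg:
  "sofic_metric_mdim G X \<alpha> d \<sigma> p = -\<infinity> \<or> 0 \<le> sofic_metric_mdim G X \<alpha> d \<sigma> p"
proof (cases "\<exists>\<rho>. continuous_pseudometric X \<rho> \<and> dynamically_generating G X \<alpha> \<rho> \<and> mdim p \<rho> = -\<infinity>")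
  case True
  then obtain \<rho> where "\<rho> \<in> {\<rho>. continuous_pseudometric X \<rho> \<and> dynamically_generating G X \<alpha> \<rho>}" "mdim p \<rho> = -\<infinity>"
    by blast
  then have "sofic_metric_mdim G X \<alpha> d \<sigma> p \<le> -\<infinity>"
    unfolding sofic_metric_mdim_def by (metis INF_lower)
  then show ?thesis by simp
next
  case False
  then have "0 \<le> sofic_metric_mdim G X \<alpha> d \<sigma> p"
    unfolding sofic_metric_mdim_def using mdim_minf_or_nonneg by (intro INF_greatest) blast
  then show ?thesis ..
qed

text \<open>
  With \<open>?P\<close> the generating pseudometrics and \<open>?T\<close> the tame compatible metrics, the infima form a
  cycle of inequalities, closed by \<open>tame_metric_below_pseudometric\<close>.
\<close>

lemma mdim_infima_agree:
  assumes "1 \<le> q"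
  shows "sofic_metric_mdim G X \<alpha> d \<sigma> q = sofic_metric_mdim G X \<alpha> d \<sigma> \<infinity>"
    and "(INF \<rho>\<in>{\<rho>. compatible_metric X \<rho> \<and> tame_growth X \<rho>}. mdim q \<rho>) = sofic_metric_mdim G X \<alpha> d \<sigma> \<infinity>"
proof -
  let ?P = "{\<rho>. continuous_pseudometric X \<rho> \<and> dynamically_generating G X \<alpha> \<rho>}"
  let ?T = "{\<rho>. compatible_metric X \<rho> \<and> tame_growth X \<rho>}"
  have sub: "?T \<subseteq> ?P"
    using compatible_metric_imp_continuous_pseudometric compatible_metric_generating by blast
  have T_I: "(INF \<rho>\<in>?T. mdim \<infinity> \<rho>) \<le> (INF \<rho>\<in>?P. mdim 1 \<rho>)"
  proof (rule INF_mono)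
    fix \<rho> assume "\<rho> \<in> ?P"
    then obtain D where "compatible_metric X D" "tame_growth X D" "mdim \<infinity> D \<le> mdim 1 \<rho>"
      using tame_metric_below_pseudometric by blast
    then show "\<exists>D\<in>?T. mdim \<infinity> D \<le> mdim 1 \<rho>" by blast
  qed
  have I_1: "(INF \<rho>\<in>?P. mdim 1 \<rho>) \<le> (INF \<rho>\<in>?P. mdim q \<rho>)"
    using assms by (intro INF_mono) (blast intro: mdim_1_le)
  have I_q: "(INF \<rho>\<in>?P. mdim q \<rho>) \<le> (INF \<rho>\<in>?P. mdim \<infinity> \<rho>)"
    using assms by (intro INF_mono) (blast intro: mdim_le_infinity)
  have I_T: "(INF \<rho>\<in>?P. mdim p \<rho>) \<le> (INF \<rho>\<in>?T. mdim p \<rho>)" for p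
    by (rule INF_superset_mono[OF sub]) simp
  have T_q: "(INF \<rho>\<in>?T. mdim q \<rho>) \<le> (INF \<rho>\<in>?T. mdim \<infinity> \<rho>)"
    using assms sub by (intro INF_mono) (blast intro: mdim_le_infinity)
  have le_q: "(INF \<rho>\<in>?P. mdim \<infinity> \<rho>) \<le> (INF \<rho>\<in>?P. mdim q \<rho>)"
    by (rule order_trans[OF I_T order_trans[OF T_I I_1]])
  show "sofic_metric_mdim G X \<alpha> d \<sigma> q = sofic_metric_mdim G X \<alpha> d \<sigma> \<infinity>"
    unfolding sofic_metric_mdim_def by (rule antisym[OF I_q le_q])
  have "(INF \<rho>\<in>?T. mdim q \<rho>) \<le> (INF \<rho>\<in>?P. mdim \<infinity> \<rho>)"
    by (rule order_trans[OF T_q order_trans[OF T_I order_trans[OF I_1 I_q]]])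
  moreover have "(INF \<rho>\<in>?P. mdim \<infinity> \<rho>) \<le> (INF \<rho>\<in>?T. mdim q \<rho>)"
    by (rule order_trans[OF le_q I_T])
  ultimately show "(INF \<rho>\<in>?T. mdim q \<rho>) = sofic_metric_mdim G X \<alpha> d \<sigma> \<infinity>"
    unfolding sofic_metric_mdim_def by (rule antisym)
qed

end

theorem theorem1p1:
  fixes G :: "('g, 'm) monoid_scheme"
    and X :: "'x topology"
    and \<alpha> :: "'g \<Rightarrow> 'x \<Rightarrow> 'x"
    and d :: "nat \<Rightarrow> nat"
    and \<sigma> :: "nat \<Rightarrow> 'g \<Rightarrow> nat \<Rightarrow> nat"
  assumes "group G" and "countable (carrier G)" and "sofic_group G"
    and "compact_space X" and "metrizable_space X" and "topspace X \<noteq> {}"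
    and "group_action G (topspace X) \<alpha>"
    and "\<And>g. g \<in> carrier G \<Longrightarrow> homeomorphic_map X X (\<alpha> g)"
    and "sofic_approximation G d \<sigma>"
  shows "\<exists>D::ereal. (D = -\<infinity> \<or> 0 \<le> D) \<and>
           (\<forall>p::ereal. 1 \<le> p \<and> p < \<infinity> \<longrightarrow>
              D = sofic_metric_mdim G X \<alpha> d \<sigma> p \<and>
              sofic_metric_mdim G X \<alpha> d \<sigma> p = sofic_metric_mdim G X \<alpha> d \<sigma> \<infinity>) \<and>
           (\<forall>q::ereal. 1 \<le> q \<longrightarrow>
              D = (INF \<rho>\<in>{\<rho>. compatible_metric X \<rho> \<and> tame_growth X \<rho>}.
                     lower_sofic_mdim G X \<alpha> d \<sigma> q \<rho>))"
proof -
  interpret sofic_dynamics G X \<alpha> d \<sigma>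
    using assms by (intro sofic_dynamics.intro)
  show ?thesis
  proof (intro exI[of _ "sofic_metric_mdim G X \<alpha> d \<sigma> \<infinity>"] conjI allI impI)
    show "sofic_metric_mdim G X \<alpha> d \<sigma> \<infinity> = -\<infinity> \<or> 0 \<le> sofic_metric_mdim G X \<alpha> d \<sigma> \<infinity>"
      by (rule sofic_metric_mdim_minf_or_nonneg)
    fix p :: ereal assume "1 \<le> p \<and> p < \<infinity>"
    then show "sofic_metric_mdim G X \<alpha> d \<sigma> p = sofic_metric_mdim G X \<alpha> d \<sigma> \<infinity>"
      and "sofic_metric_mdim G X \<alpha> d \<sigma> \<infinity> = sofic_metric_mdim G X \<alpha> d \<sigma> p"
      using mdim_infima_agree(1)[of p] by simp_all
  next
    fix q :: ereal assume "1 \<le> q"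
    then show "sofic_metric_mdim G X \<alpha> d \<sigma> \<infinity>
        = (INF \<rho>\<in>{\<rho>. compatible_metric X \<rho> \<and> tame_growth X \<rho>}. mdim q \<rho>)"
      by (rule mdim_infima_agree(2)[symmetric])
  qed
qed

end
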